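(* Let $\alpha\in(0,1]$, $s\in\mathbb R$ and $T>0$. Then there does not exist a (normed) space $X_T$ continuously embedded in $C([0,T];H^s(\mathbb R^2))$ for which there exists $C>0$ with $$\|U_{\alpha}(\cdot_t)\phi\|_{X_T}\leq C\|\phi\|_{H^s(\mathbb R^2)}\quad\text{for all }\phi\in H^s(\mathbb R^2),$$ and $$\left\|\int_0^{\cdot_t}U_{\alpha}(\cdot_t-t')\bigl(u(t')u_x(t')\bigr)\,dt'\right\|_{X_T}\leq C\|u\|_{X_T}^2\quad\text{for all }u\in X_T.$$
   Context: For $t\in\mathbb R$, $U_{\alpha}(t)$ is the operator defined through the Fourier transform in $(x,y)\in\mathbb R^2$ (dual variables $(\xi,\eta)$) by $\widehat{U_{\alpha}(t)\phi}(\xi,\eta)=e^{-it(|\xi|^{\alpha}\xi+\mathrm{sgn}(\xi)\eta^2)}\widehat\phi(\xi,\eta)$. It is the solution group of the linear equation $u_t+D_x^{\alpha}u_x+\mathcal Hu_{yy}=0$, where $D_x^\alpha$ has symbol $|\xi|^\alpha$ and $\mathcal H$ has symbol $-i\,\mathrm{sgn}(\xi)$. The symbol $\cdot_t$ indicates the time variable in $[0,T]$, so the two expressions measured in $X_T$ are the functions $t\mapsto U_\alpha(t)\phi$ and $t\mapsto\int_0^tU_\alpha(t-t')(u(t')u_x(t'))\,dt'$. $H^s(\mathbb R^2)$ is the usual $L^2$-based Sobolev space of (complex-valued) functions/distributions. The two inequalities are understood to include the assertion that the quantities on their left-hand sides are well defined elements of $X_T$. *)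

theory Defs
  imports "HOL-Analysis.Analysis"
begin

section \<open>Schwartz functions and tempered distributions on the plane\<close>

type_synonym plane = "real \<times> real"

type_synonym distr = "(plane \<Rightarrow> complex) \<Rightarrow> complex"

primrec iter_deriv :: "plane list \<Rightarrow> (plane \<Rightarrow> complex) \<Rightarrow> plane \<Rightarrow> complex" where
  "iter_deriv [] f = f"
| "iter_deriv (e # es) f = (\<lambda>z. frechet_derivative (iter_deriv es f) (at z) e)"

text \<open>Basis is the set of the two unit vectors, so the words \<open>es\<close> range over all iterated partial
  derivatives.\<close>

definition schwartz :: "(plane \<Rightarrow> complex) \<Rightarrow> bool" where
  "schwartz f \<longleftrightarrow> (\<forall>es. set es \<subseteq> Basis \<longrightarrow>
     (\<forall>z. iter_deriv es f differentiable (at z)) \<and>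
     (\<forall>k::nat. \<exists>B. \<forall>z. (1 + norm z) ^ k * norm (iter_deriv es f z) \<le> B))"

definition schwartz_seminorm :: "nat \<Rightarrow> (plane \<Rightarrow> complex) \<Rightarrow> real" where
  "schwartz_seminorm k f =
     (SUP z. (1 + norm z) ^ k *
        (\<Sum>es | set es \<subseteq> Basis \<and> length es \<le> k. norm (iter_deriv es f z)))"

text \<open>Functionals act on all functions \<^typ>\<open>plane \<Rightarrow> complex\<close>; the value off the Schwartz space is
  fixed to be 0, so that equality of tempered distributions is equality of functionals.\<close>

definition tempered :: "distr \<Rightarrow> bool" where
  "tempered u \<longleftrightarrow>
     (\<forall>f g. schwartz f \<longrightarrow> schwartz g \<longrightarrow> u (\<lambda>z. f z + g z) = u f + u g) \<and>
     (\<forall>c f. schwartz f \<longrightarrow> u (\<lambda>z. c * f z) = c * u f) \<and>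
     (\<exists>C k. \<forall>f. schwartz f \<longrightarrow> norm (u f) \<le> C * schwartz_seminorm k f) \<and>
     (\<forall>f. \<not> schwartz f \<longrightarrow> u f = 0)"

definition distr_dx :: "distr \<Rightarrow> distr" where
  "distr_dx u f = (if schwartz f then - u (iter_deriv [(1, 0)] f) else 0)"


section \<open>Fourier transform\<close>

definition fourier :: "(plane \<Rightarrow> complex) \<Rightarrow> plane \<Rightarrow> complex" where
  "fourier f \<zeta> = (LINT z|lborel. cis (- (z \<bullet> \<zeta>)) * f z)"

definition inv_fourier :: "(plane \<Rightarrow> complex) \<Rightarrow> plane \<Rightarrow> complex" where
  "inv_fourier f z = of_real (1 / (2 * pi)\<^sup>2) * (LINT \<zeta>|lborel. cis (z \<bullet> \<zeta>) * f \<zeta>)"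

text \<open>The Fourier transform of \<open>u\<close>, i.e. the distribution sending \<open>f\<close> to \<open>u (fourier f)\<close>, is the
  function \<open>g\<close>. Such a \<open>g\<close> is unique up to null sets; \<open>fourier_fun\<close> picks a representative.\<close>

definition has_fourier_fun :: "distr \<Rightarrow> (plane \<Rightarrow> complex) \<Rightarrow> bool" where
  "has_fourier_fun u g \<longleftrightarrow> g \<in> borel_measurable lborel \<and>
     (\<forall>f. schwartz f \<longrightarrow> integrable lborel (\<lambda>\<zeta>. g \<zeta> * f \<zeta>) \<and>
        u (fourier f) = (LINT \<zeta>|lborel. g \<zeta> * f \<zeta>))"

definition fourier_fun :: "distr \<Rightarrow> plane \<Rightarrow> complex" where
  "fourier_fun u = (SOME g. has_fourier_fun u g)"

text \<open>The inverse Fourier transform, in the sense of distributions, of the function \<open>g\<close>.\<close>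

definition inv_fourier_distr :: "(plane \<Rightarrow> complex) \<Rightarrow> distr" where
  "inv_fourier_distr g f =
     (if schwartz f then LINT \<zeta>|lborel. g \<zeta> * inv_fourier f \<zeta> else 0)"


section \<open>Sobolev spaces\<close>

definition sobolev :: "real \<Rightarrow> distr set" where
  "sobolev s = {u. tempered u \<and> (\<exists>g. has_fourier_fun u g \<and>
     integrable lborel (\<lambda>\<zeta>. (1 + (norm \<zeta>)\<^sup>2) powr s * (norm (g \<zeta>))\<^sup>2))}"

definition sobolev_norm :: "real \<Rightarrow> distr \<Rightarrow> real" where
  "sobolev_norm s u =
     sqrt (LINT \<zeta>|lborel. (1 + (norm \<zeta>)\<^sup>2) powr s * (norm (fourier_fun u \<zeta>))\<^sup>2)"

text \<open>A function on the time interval \<open>[0, T]\<close> is represented by its extension by zero.\<close>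

definition on_interval :: "real \<Rightarrow> (real \<Rightarrow> distr) \<Rightarrow> real \<Rightarrow> distr" where
  "on_interval T u = (\<lambda>t. if t \<in> {0..T} then u t else (\<lambda>f. 0))"

definition C_sobolev :: "real \<Rightarrow> real \<Rightarrow> (real \<Rightarrow> distr) set" where
  "C_sobolev T s = {u. on_interval T u = u \<and> (\<forall>t\<in>{0..T}. u t \<in> sobolev s \<and>
     ((\<lambda>r. sobolev_norm s (\<lambda>f. u r f - u t f)) \<longlongrightarrow> 0) (at t within {0..T}))}"

definition C_sobolev_norm :: "real \<Rightarrow> real \<Rightarrow> (real \<Rightarrow> distr) \<Rightarrow> real" where
  "C_sobolev_norm T s u = (SUP t\<in>{0..T}. sobolev_norm s (u t))"


section \<open>The linear group and the Duhamel term\<close>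

definition disp_symbol :: "real \<Rightarrow> plane \<Rightarrow> real" where
  "disp_symbol \<alpha> = (\<lambda>(\<xi>, \<eta>). \<bar>\<xi>\<bar> powr \<alpha> * \<xi> + sgn \<xi> * \<eta>\<^sup>2)"

definition U :: "real \<Rightarrow> real \<Rightarrow> distr \<Rightarrow> distr" where
  "U \<alpha> t u = inv_fourier_distr (\<lambda>\<zeta>. cis (- t * disp_symbol \<alpha> \<zeta>) * fourier_fun u \<zeta>)"

text \<open>Convolution of \<open>u\<close> with the rescaled function \<open>\<epsilon>\<^sup>-\<^sup>2 \<rho>(\<cdot>/\<epsilon>)\<close>.\<close>

definition mollify :: "(plane \<Rightarrow> complex) \<Rightarrow> real \<Rightarrow> distr \<Rightarrow> plane \<Rightarrow> complex" where
  "mollify \<rho> \<epsilon> u z = u (\<lambda>w. of_real (1 / \<epsilon>\<^sup>2) * \<rho> ((1 / \<epsilon>) *\<^sub>R (z - w)))"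

text \<open>The product of two tempered distributions exists and equals \<open>w\<close> if the products of their
  regularizations converge to \<open>w\<close>, for every choice of the mollifier. It is the pointwise product
  when \<open>u\<close> and \<open>v\<close> are functions in \<open>L\<^sup>2\<close>, and for \<open>u\<close> in \<open>L\<^sup>2\<close> the product of \<open>u\<close> and \<open>u\<^sub>x\<close> is
  the distributional derivative of \<open>u\<^sup>2/2\<close>.\<close>

definition has_product :: "distr \<Rightarrow> distr \<Rightarrow> distr \<Rightarrow> bool" where
  "has_product u v w \<longleftrightarrow> tempered w \<and>
     (\<forall>\<rho> f. schwartz \<rho> \<longrightarrow> (LINT z|lborel. \<rho> z) = 1 \<longrightarrow> schwartz f \<longrightarrow>
        ((\<lambda>\<epsilon>. LINT z|lborel. mollify \<rho> \<epsilon> u z * mollify \<rho> \<epsilon> v z * f z) \<longlongrightarrow> w f) (at_right 0))"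

text \<open>\<open>v\<close> is the Duhamel term \<open>t \<mapsto> \<integral>\<^sub>0\<^sup>t U(t - t') (u(t') u\<^sub>x(t')) dt'\<close> of \<open>u\<close>: the integrand \<open>w\<close> exists
  for almost all times and lies in the domain of the group (its Fourier transform is a function),
  and the time integral is taken in the sense of distributions.\<close>

definition is_duhamel :: "real \<Rightarrow> real \<Rightarrow> (real \<Rightarrow> distr) \<Rightarrow> (real \<Rightarrow> distr) \<Rightarrow> bool" where
  "is_duhamel \<alpha> T u v \<longleftrightarrow> (\<exists>w.
     (AE t' in lborel. t' \<in> {0..T} \<longrightarrow>
        has_product (u t') (distr_dx (u t')) (w t') \<and> (\<exists>g. has_fourier_fun (w t') g)) \<and>
     (\<forall>t\<in>{0..T}. \<forall>f. schwartz f \<longrightarrow>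
        set_integrable lborel {0..t} (\<lambda>t'. U \<alpha> (t - t') (w t') f) \<and>
        v t f = (LINT t':{0..t}|lborel. U \<alpha> (t - t') (w t') f)))"


section \<open>Normed spaces of distribution-valued functions of time\<close>

text \<open>Scalars are real; a complex normed space is in particular a real one.\<close>

definition normed_space_on :: "(real \<Rightarrow> distr) set \<Rightarrow> ((real \<Rightarrow> distr) \<Rightarrow> real) \<Rightarrow> bool" where
  "normed_space_on X nrm \<longleftrightarrow>
     (\<lambda>t f. 0) \<in> X \<and>
     (\<forall>u\<in>X. \<forall>v\<in>X. (\<lambda>t f. u t f + v t f) \<in> X \<and> nrm (\<lambda>t f. u t f + v t f) \<le> nrm u + nrm v) \<and>
     (\<forall>c::real. \<forall>u\<in>X. (\<lambda>t f. of_real c * u t f) \<in> X \<and>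
        nrm (\<lambda>t f. of_real c * u t f) = \<bar>c\<bar> * nrm u) \<and>
     (\<forall>u\<in>X. 0 \<le> nrm u \<and> (nrm u = 0 \<longleftrightarrow> u = (\<lambda>t f. 0)))"

definition continuously_embedded ::
  "(real \<Rightarrow> distr) set \<Rightarrow> ((real \<Rightarrow> distr) \<Rightarrow> real) \<Rightarrow> real \<Rightarrow> real \<Rightarrow> bool" where
  "continuously_embedded X nrm T s \<longleftrightarrow>
     X \<subseteq> C_sobolev T s \<and> (\<exists>K. \<forall>u\<in>X. C_sobolev_norm T s u \<le> K * nrm u)"

end

theory Submission
  imports Defs "HOL-Probability.Sinc_Integral" "HOL-Probability.Characteristic_Functions"
begin

text \<open>The two estimates would make the Duhamel term of a free evolution \<open>U(t)\<phi>\<close> bounded by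
  \<open>\<parallel>\<phi>\<parallel>\<^sup>2\<close> in \<open>H\<^sup>s\<close>, uniformly on \<open>[0,T]\<close>. Let \<open>\<phi>\<close> have the Fourier transform
  \<open>1\<^sub>L + N\<^sup>-\<^sup>s 1\<^sub>H\<close>, where \<open>L\<close> is a rectangle of size \<open>\<gamma> \<times> \<beta>\<close> at low frequency and \<open>H\<close> a comparable
  one at \<open>\<xi> \<approx> N\<close>. For \<open>\<gamma> \<sim> 1/(T N)\<close> and \<open>\<beta>\<^sup>2 \<lesssim> 1/T\<close> the resonance function
  \<open>p(\<zeta>) - p(\<omega>) - p(\<zeta> - \<omega>)\<close> of the symbol \<open>p\<close> is at most \<open>1/T\<close> on the interaction of \<open>L\<close> with \<open>H\<close>,
  so the time integral does not oscillate, and the derivative falls on the high frequency: the Duhamel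
  term at time \<open>T\<close> has norm of order \<open>N (\<gamma>\<beta>)\<^sup>3\<^sup>/\<^sup>2\<close>, whereas \<open>\<parallel>\<phi>\<parallel>\<^sup>2\<close> is of order \<open>\<gamma>\<beta>\<close>. As \<open>N\<^sup>2\<gamma>\<beta> \<sim> N\<close>
  is unbounded, this is impossible.\<close>

section \<open>Schwartz functions\<close>

text \<open>The factor N^(-s) cancels the weight N^(2s) of H^s in the data and again in the output,
  which also sits near \<xi> = N; whatever the sign of s, only factors 16^|s| remain. The rectangles
  lie in \<xi> > 0, where sgn \<xi> = 1, and for low \<xi> and high \<xi>' the resonance function is
  at most 3 \<xi> \<xi>' + 2 |\<eta> \<eta>'|. The first term has this form for every \<alpha> \<le>
  1, so one choice of rectangles serves all exponents. The data have nonnegative transform and \<xi>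
  > 0 on its support, so the two orders of interaction cannot cancel.

  The obstacle is that nothing about the nonlinear term is given pointwise: the product is a limit
  of regularizations, the time integral is taken against test functions, and
  \<open>fourier_fun\<close> is a choice. That some \<open>v\<close> is a Duhamel term has to force
  the transform of \<open>v T\<close>. Gaussians achieve this: as mollifiers they act by explicit
  damping factors, as regularizers they give Fourier inversion, and as test functions they show that
  a transform which is a function is unique almost everywhere.\<close>

definition pd :: "plane \<Rightarrow> (plane \<Rightarrow> complex) \<Rightarrow> plane \<Rightarrow> complex" where
  "pd e f z = frechet_derivative f (at z) e"

definition rapid :: "(plane \<Rightarrow> complex) \<Rightarrow> bool" where
  "rapid f \<longleftrightarrow> (\<forall>k::nat. \<exists>B. \<forall>z. (1 + norm z) ^ k * norm (f z) \<le> B)"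

lemma iter_deriv_Cons: "iter_deriv (e # es) f = pd e (iter_deriv es f)"
  by (simp add: pd_def[abs_def])

text \<open>The last letter of a word acts first. This is what makes \<open>schwartz\<close> stable
  under \<open>pd\<close>.\<close>

lemma iter_deriv_snoc: "iter_deriv (es @ [e]) f = iter_deriv es (pd e f)"
  by (induction es) (simp_all add: pd_def[abs_def])

lemma iter_deriv_single: "iter_deriv [e] f = pd e f"
  by (simp add: pd_def[abs_def])

lemma pd_eqI: "(f has_derivative f') (at z) \<Longrightarrow> pd e f z = f' e"
  unfolding pd_def using frechet_derivative_at by metis

lemma has_derivative_pd: "f differentiable (at z) \<Longrightarrow> (f has_derivative (\<lambda>e. pd e f z)) (at z)"
  unfolding pd_def by (simp add: frechet_derivative_works)

lemma schwartz_iff: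
  "schwartz f \<longleftrightarrow> (\<forall>es. set es \<subseteq> Basis \<longrightarrow>
     (\<forall>z. iter_deriv es f differentiable (at z)) \<and> rapid (iter_deriv es f))"
  unfolding schwartz_def rapid_def by blast

text \<open>Replaces the computation of iterated derivatives: a set that is stable under the
  coordinate derivatives contains all of them, so decay and differentiability are checked once, for
  a general element.\<close>

lemma schwartz_coinduct:
  assumes "f \<in> S"
    and "\<And>g. g \<in> S \<Longrightarrow>
      (\<forall>z. g differentiable (at z)) \<and> rapid g \<and> (\<forall>e\<in>Basis. pd e g \<in> S)"
  shows "schwartz f"
proof -
  have "iter_deriv es f \<in> S" if "set es \<subseteq> Basis" for es
    using that by (induction es) (use assms in \<open>auto simp: iter_deriv_Cons simp del: iter_deriv.simps(2)\<close>)
  with assms show ?thesis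
    unfolding schwartz_iff by blast
qed

lemma schwartz_pd: "schwartz f \<Longrightarrow> e \<in> Basis \<Longrightarrow> schwartz (pd e f)"
  unfolding schwartz_iff iter_deriv_snoc[symmetric] by auto

lemma schwartz_differentiable: "schwartz f \<Longrightarrow> f differentiable (at z)"
  using schwartz_iff[of f] by (metis empty_set empty_subsetI iter_deriv.simps(1))

lemma schwartz_rapid: "schwartz f \<Longrightarrow> rapid f"
  using schwartz_iff[of f] by (metis empty_set empty_subsetI iter_deriv.simps(1))

lemma schwartz_continuous: "schwartz f \<Longrightarrow> continuous_on A f"
  by (meson continuous_at_imp_continuous_on differentiable_imp_continuous_within schwartz_differentiable)

lemma schwartz_measurable: "schwartz f \<Longrightarrow> f \<in> borel_measurable borel"
  by (intro borel_measurable_continuous_onI schwartz_continuous)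

lemma rapidD:
  assumes "rapid f"
  obtains B where "\<And>z. (1 + norm z) ^ k * norm (f z) \<le> B" "0 \<le> B"
proof -
  obtain B where B: "\<And>z. (1 + norm z) ^ k * norm (f z) \<le> B"
    using assms unfolding rapid_def by blast
  moreover have "0 \<le> B"
    by (rule order_trans[OF _ B[of 0]]) simp
  ultimately show ?thesis using that by blast
qed

lemma rapid_add: "rapid f \<Longrightarrow> rapid g \<Longrightarrow> rapid (\<lambda>z. f z + g z)"
  unfolding rapid_def
proof
  fix k assume "\<forall>k::nat. \<exists>B. \<forall>z. (1 + norm z) ^ k * norm (f z) \<le> B"
    "\<forall>k::nat. \<exists>B. \<forall>z. (1 + norm z) ^ k * norm (g z) \<le> B"
  then obtain B C where B: "\<And>z. (1 + norm z) ^ k * norm (f z) \<le> B"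
    and C: "\<And>z. (1 + norm z) ^ k * norm (g z) \<le> C" by meson
  have "(1 + norm z) ^ k * norm (f z + g z) \<le> B + C" for z
  proof -
    have "(1 + norm z) ^ k * norm (f z + g z) \<le> (1 + norm z) ^ k * (norm (f z) + norm (g z))"
      by (intro mult_left_mono norm_triangle_ineq) auto
    also have "\<dots> \<le> B + C" using B[of z] C[of z] by (simp add: distrib_left)
    finally show ?thesis .
  qed
  then show "\<exists>B. \<forall>z. (1 + norm z) ^ k * norm (f z + g z) \<le> B" by blast
qed

text \<open>A polynomial factor of degree \<open>m\<close> only shifts the exponent, since the decay
  of \<open>f\<close> holds for every power.\<close>

lemma rapid_dominated:
  assumes f: "rapid f" and g: "\<And>z. norm (g z) \<le> C * (1 + norm z) ^ m * norm (f z)"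
  shows "rapid g"
  unfolding rapid_def
proof
  fix k
  obtain B where B: "\<And>z. (1 + norm z) ^ (k + m) * norm (f z) \<le> B" "0 \<le> B"
    using rapidD[OF f] by blast
  have "(1 + norm z) ^ k * norm (g z) \<le> \<bar>C\<bar> * B" for z
  proof -
    have "(1 + norm z) ^ k * norm (g z) \<le> (1 + norm z) ^ k * (\<bar>C\<bar> * (1 + norm z) ^ m * norm (f z))"
      by (intro mult_left_mono order_trans[OF g] mult_right_mono) auto
    also have "\<dots> = \<bar>C\<bar> * ((1 + norm z) ^ (k + m) * norm (f z))" by (simp add: power_add)
    also have "\<dots> \<le> \<bar>C\<bar> * B" by (intro mult_left_mono B) auto
    finally show ?thesis .
  qed
  then show "\<exists>B. \<forall>z. (1 + norm z) ^ k * norm (g z) \<le> B" by blast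
qed

lemma inner_le_1: "e \<in> Basis \<Longrightarrow> \<bar>z \<bullet> e\<bar> \<le> 1 + norm (z::plane)"
  using Basis_le_norm[of e z] by linarith

text \<open>Closure under multiplication by coordinates makes the Schwartz property coinductive for
  polynomials times Gaussians and for polynomials times Schwartz functions alike.\<close>

inductive_set poly_span :: "(plane \<Rightarrow> complex) set \<Rightarrow> (plane \<Rightarrow> complex) set" for B where
  base: "f \<in> B \<Longrightarrow> f \<in> poly_span B"
| add: "f \<in> poly_span B \<Longrightarrow> g \<in> poly_span B \<Longrightarrow> (\<lambda>z. f z + g z) \<in> poly_span B"
| scale: "f \<in> poly_span B \<Longrightarrow> (\<lambda>z. c * f z) \<in> poly_span B"
| coord: "f \<in> poly_span B \<Longrightarrow> e \<in> Basis \<Longrightarrow> (\<lambda>z. of_real (z \<bullet> e) * f z) \<in> poly_span B"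

text \<open>Only the generators need checking: by the product rule the derivative of a coordinate
  multiple lies in the span again.\<close>

lemma schwartz_poly_span:
  assumes B: "\<And>g. g \<in> B \<Longrightarrow>
      (\<forall>z. g differentiable (at z)) \<and> rapid g \<and> (\<forall>e\<in>Basis. pd e g \<in> poly_span B)"
    and f: "f \<in> poly_span B"
  shows "schwartz f"
proof (rule schwartz_coinduct[OF f])
  fix g assume "g \<in> poly_span B"
  then show "(\<forall>z. g differentiable (at z)) \<and> rapid g \<and> (\<forall>e\<in>Basis. pd e g \<in> poly_span B)"
  proof induction
    case (base f)
    then show ?case using B by blast
  next
    case (add f g)
    then have f: "\<And>z. f differentiable (at z)" "rapid f" "\<And>e. e \<in> Basis \<Longrightarrow> pd e f \<in> poly_span B"
      and g: "\<And>z. g differentiable (at z)" "rapid g" "\<And>e. e \<in> Basis \<Longrightarrow> pd e g \<in> poly_span B"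
      by blast+
    have D: "((\<lambda>z. f z + g z) has_derivative (\<lambda>e. pd e f z + pd e g z)) (at z)" for z
      by (intro has_derivative_add has_derivative_pd f g)
    have "pd e (\<lambda>z. f z + g z) = (\<lambda>z. pd e f z + pd e g z)" for e
      using pd_eqI[OF D] by blast
    then show ?case
      using differentiableI[OF D] rapid_add[OF f(2) g(2)] poly_span.add[OF f(3) g(3)] by metis
  next
    case (scale f c)
    then have f: "\<And>z. f differentiable (at z)" "rapid f" "\<And>e. e \<in> Basis \<Longrightarrow> pd e f \<in> poly_span B"
      by blast+
    have D: "((\<lambda>z. c * f z) has_derivative (\<lambda>e. c * pd e f z)) (at z)" for z
      by (intro has_derivative_mult_right has_derivative_pd f)
    have "pd e (\<lambda>z. c * f z) = (\<lambda>z. c * pd e f z)" for e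
      using pd_eqI[OF D] by blast
    moreover have "rapid (\<lambda>z. c * f z)"
      by (rule rapid_dominated[OF f(2), of _ "norm c" 0]) (simp add: norm_mult)
    ultimately show ?case
      using differentiableI[OF D] poly_span.scale[OF f(3)] by metis
  next
    case (coord f e)
    then have f: "\<And>z. f differentiable (at z)" "rapid f" "\<And>e. e \<in> Basis \<Longrightarrow> pd e f \<in> poly_span B"
      by blast+
    have D: "((\<lambda>z. of_real (z \<bullet> e) * f z) has_derivative
        (\<lambda>d. of_real (z \<bullet> e) * pd d f z + of_real (d \<bullet> e) * f z)) (at z)" for z
      by (rule has_derivative_mult[OF _ has_derivative_pd[OF f(1)]])
        (auto intro!: derivative_eq_intros)
    have "pd d (\<lambda>z. of_real (z \<bullet> e) * f z) =
        (\<lambda>z. of_real (z \<bullet> e) * pd d f z + of_real (d \<bullet> e) * f z)" for d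
      using pd_eqI[OF D] by blast
    moreover have "rapid (\<lambda>z. of_real (z \<bullet> e) * f z)"
      by (rule rapid_dominated[OF f(2), of _ 1 1])
        (simp add: norm_mult mult_right_mono inner_le_1[OF coord.hyps(2)])
    moreover have "(\<lambda>z. of_real (z \<bullet> e) * pd d f z + of_real (d \<bullet> e) * f z) \<in> poly_span B"
      if "d \<in> Basis" for d
      by (intro poly_span.add poly_span.scale poly_span.coord f that coord.hyps)
    ultimately show ?case
      using differentiableI[OF D] by metis
  qed
qed

lemma schwartz_poly_span_schwartz: "f \<in> poly_span (Collect schwartz) \<Longrightarrow> schwartz f"
  by (erule schwartz_poly_span[rotated])
    (auto intro: schwartz_differentiable schwartz_rapid schwartz_pd poly_span.base)

lemma schwartz_add: "schwartz f \<Longrightarrow> schwartz g \<Longrightarrow> schwartz (\<lambda>z. f z + g z)"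
  by (intro schwartz_poly_span_schwartz poly_span.add poly_span.base) auto

lemma schwartz_scale: "schwartz f \<Longrightarrow> schwartz (\<lambda>z. c * f z)"
  by (intro schwartz_poly_span_schwartz poly_span.scale poly_span.base) auto

lemma schwartz_coord: "schwartz f \<Longrightarrow> e \<in> Basis \<Longrightarrow> schwartz (\<lambda>z. of_real (z \<bullet> e) * f z)"
  by (intro schwartz_poly_span_schwartz poly_span.coord poly_span.base) auto

lemma schwartz_bounded:
  assumes "schwartz f"
  obtains B where "\<And>z. norm (f z) \<le> B" "0 \<le> B"
  using rapidD[OF schwartz_rapid[OF assms], of 0] by auto

section \<open>Integration on the plane\<close>

lemma lborel_integral_affine:
  fixes f :: "'a::euclidean_space \<Rightarrow> 'b::{banach, second_countable_topology}"
  assumes [measurable]: "f \<in> borel_measurable borel" and c: "c \<noteq> 0"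
  shows "(LINT x|lborel. f x) = \<bar>c\<bar> ^ DIM('a) *\<^sub>R (LINT x|lborel. f (t + c *\<^sub>R x))"
  by (subst lborel_affine[OF c, of t]) (simp add: integral_density integral_distr)

lemma lborel_integrable_affine:
  fixes f :: "'a::euclidean_space \<Rightarrow> 'b::{banach, second_countable_topology}"
  assumes "integrable lborel f" and c: "c \<noteq> 0"
  shows "integrable lborel (\<lambda>x. f (t + c *\<^sub>R x))"
proof -
  have [measurable]: "f \<in> borel_measurable borel" using assms(1) by auto
  have "integrable lborel (\<lambda>x. \<bar>c\<bar> ^ DIM('a) *\<^sub>R f (t + c *\<^sub>R x))"
    using assms by (subst (asm) lborel_affine[OF c, of t]) (simp add: integrable_density integrable_distr_eq)
  from integrable_scaleR_right[OF this, of "inverse (\<bar>c\<bar> ^ DIM('a))"] c show ?thesis by simp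
qed

lemma integral_times_prod:
  fixes f g :: "real \<Rightarrow> 'a::{real_normed_field, banach, second_countable_topology}"
  assumes f: "integrable lborel f" and g: "integrable lborel g"
  shows "integrable lborel (\<lambda>z. f (fst z) * g (snd z))"
    and "(LINT z|lborel. f (fst z) * g (snd z)) = (LINT x|lborel. f x) * (LINT y|lborel. g y)"
proof -
  have I: "integrable (lborel \<Otimes>\<^sub>M lborel) (\<lambda>z. f (fst z) * g (snd z))"
    by (rule lborel_pair.Fubini_integrable) (use f g in \<open>auto simp: norm_mult\<close>)
  then show "integrable lborel (\<lambda>z. f (fst z) * g (snd z))" by (simp add: lborel_prod)
  show "(LINT z|lborel. f (fst z) * g (snd z)) = (LINT x|lborel. f x) * (LINT y|lborel. g y)"
    unfolding lborel_prod[symmetric]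
    by (subst lborel_pair.integral_fst'[OF I, symmetric]) simp
qed

text \<open>A product of two Cauchy kernels, so that integrability reduces to the line. Four powers
  of \<open>1 + norm z\<close> dominate its inverse, which is why the exponent 4 recurs
  below.\<close>

definition weight :: "plane \<Rightarrow> real" where
  "weight z = inverse (1 + (fst z)\<^sup>2) * inverse (1 + (snd z)\<^sup>2)"

lemma integrable_weight: "integrable lborel weight"
proof -
  have "integrable lborel (\<lambda>x::real. inverse (1 + x\<^sup>2))"
    using integrable_inverse_1_plus_square by (simp add: set_integrable_def)
  then show ?thesis
    unfolding weight_def[abs_def] by (intro integral_times_prod(1))
qed

lemma weight_nonneg: "0 \<le> weight z"
  by (simp add: weight_def)

lemma norm_plane: "(norm (z::plane))\<^sup>2 = (fst z)\<^sup>2 + (snd z)\<^sup>2"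
  by (simp add: norm_prod_def)

lemma power4_weight: "1 \<le> (1 + norm z) ^ 4 * weight z"
proof -
  have pos: "0 < (1 + (fst z)\<^sup>2) * (1 + (snd z)\<^sup>2)"
    by (intro mult_pos_pos add_pos_nonneg) auto
  have "(1 + (fst z)\<^sup>2) * (1 + (snd z)\<^sup>2) \<le> (1 + (norm z)\<^sup>2) * (1 + (norm z)\<^sup>2)"
    by (intro mult_mono) (auto simp: norm_plane)
  also have "\<dots> \<le> (1 + norm z)\<^sup>2 * (1 + norm z)\<^sup>2"
    by (intro mult_mono) (auto simp: power2_eq_square algebra_simps)
  also have "\<dots> = (1 + norm z) ^ 4" by (simp add: power2_eq_square power4_eq_xxxx)
  finally show ?thesis
    using pos unfolding weight_def
    by (simp add: inverse_mult_distrib[symmetric] field_simps del: inverse_mult_distrib)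
qed

lemma norm_le_weight:
  assumes "(1 + norm z) ^ 4 * norm (f z) \<le> B"
  shows "norm (f z) \<le> B * weight z"
proof -
  have "norm (f z) \<le> ((1 + norm z) ^ 4 * weight z) * norm (f z)"
    using mult_right_mono[OF power4_weight[of z], of "norm (f z)"] by simp
  also have "\<dots> = ((1 + norm z) ^ 4 * norm (f z)) * weight z" by simp
  also have "\<dots> \<le> B * weight z" by (intro mult_right_mono assms weight_nonneg)
  finally show ?thesis .
qed

lemma rapid_integrable:
  assumes [measurable]: "f \<in> borel_measurable borel" and f: "rapid f"
  shows "integrable lborel f"
proof -
  obtain B where B: "\<And>z. (1 + norm z) ^ 4 * norm (f z) \<le> B" "0 \<le> B"
    using rapidD[OF f] by blast
  show ?thesis
  proof (rule Bochner_Integration.integrable_bound)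
    show "integrable lborel (\<lambda>z. B * weight z)" using integrable_weight by simp
    show "AE z in lborel. norm (f z) \<le> norm (B * weight z)"
      using order_trans[OF norm_le_weight[where f=f, OF B(1)] abs_ge_self] by auto
  qed simp
qed

lemma schwartz_integrable: "schwartz f \<Longrightarrow> integrable lborel f"
  by (intro rapid_integrable schwartz_measurable schwartz_rapid)

lemma integrable_bounded_mult:
  fixes f g :: "'a \<Rightarrow> complex"
  assumes f: "integrable M f" and [measurable]: "g \<in> borel_measurable M"
    and g: "\<And>z. norm (g z) \<le> B"
  shows "integrable M (\<lambda>z. g z * f z)"
proof (rule Bochner_Integration.integrable_bound)
  show "integrable M (\<lambda>z. B * norm (f z))" using f by simp
  show "(\<lambda>z. g z * f z) \<in> borel_measurable M" using f by measurable
  show "AE z in M. norm (g z * f z) \<le> norm (B * norm (f z))"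
    using order_trans[OF norm_ge_zero g]
    by (auto simp: norm_mult abs_mult intro!: mult_right_mono order_trans[OF g])
qed

lemma measurable_cis [measurable (raw)]:
  "\<theta> \<in> borel_measurable M \<Longrightarrow> (\<lambda>z. cis (\<theta> z)) \<in> borel_measurable M"
  unfolding cis_conv_exp by measurable

lemma integrable_cis_mult:
  fixes f :: "'a \<Rightarrow> complex"
  assumes "integrable M f" and [measurable]: "\<theta> \<in> borel_measurable M"
  shows "integrable M (\<lambda>z. cis (\<theta> z) * f z)"
  by (rule integrable_bounded_mult[OF assms(1), where B=1]) auto

text \<open>\<open>F(z + e) - F(z)\<close>, which integrates to 0, is the integral of the derivative over the segment
  from \<open>z\<close> to \<open>z + e\<close>; Fubini and translation invariance do the rest.\<close>

lemma integral_pd_eq_0: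
  fixes F :: "plane \<Rightarrow> complex"
  assumes F: "\<And>z. F differentiable (at z)" and I: "integrable lborel F"
    and c: "continuous_on UNIV (pd e F)" and I': "integrable lborel (pd e F)"
  shows "(LINT z|lborel. pd e F z) = 0"
proof -
  have [measurable]: "pd e F \<in> borel_measurable borel" "F \<in> borel_measurable borel"
    using I I' by auto
  have shift: "(LINT z|lborel. G (z + w)) = (LINT z|lborel. G z)"
    if "integrable lborel G" for G :: "plane \<Rightarrow> 'b::{banach, second_countable_topology}" and w
  proof -
    have [measurable]: "G \<in> borel_measurable borel" using that by auto
    show ?thesis using lborel_integral_affine[of G 1 w] by (simp add: add.commute)
  qed
  have shiftI: "integrable lborel (\<lambda>z. G (z + w))"
    if "integrable lborel G" for G :: "plane \<Rightarrow> complex" and w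
    using lborel_integrable_affine[OF that, of 1 w] by (simp add: add.commute)
  let ?h = "\<lambda>t z. indicator {0..1::real} t *\<^sub>R pd e F (z + t *\<^sub>R e)"
  have FI: "integrable (lborel \<Otimes>\<^sub>M lborel) (case_prod ?h)"
  proof (rule lborel_pair.Fubini_integrable)
    show "case_prod ?h \<in> borel_measurable (lborel \<Otimes>\<^sub>M lborel)" by measurable
    show "integrable lborel (\<lambda>t. LINT z|lborel. norm (case (t, z) of (t, z) \<Rightarrow> ?h t z))"
      using shift[OF integrable_norm[OF I']] by simp
    show "AE t in lborel. integrable lborel (\<lambda>z. case (t, z) of (t, z) \<Rightarrow> ?h t z)"
      using shiftI[OF I'] by auto
  qed
  have ftc: "(LINT t|lborel. ?h t z) = F (z + e) - F z" for z
  proof -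
    have "(LINT t|lborel. ?h t z) = F (z + 1 *\<^sub>R e) - F (z + 0 *\<^sub>R e)"
    proof (rule integral_FTC_atLeastAtMost)
      fix t :: real
      have "((\<lambda>t. F (z + t *\<^sub>R e)) has_derivative (\<lambda>h. pd (h *\<^sub>R e) F (z + t *\<^sub>R e)))
          (at t within {0..1})"
        by (rule has_derivative_compose[of "\<lambda>t. z + t *\<^sub>R e" "\<lambda>h. h *\<^sub>R e" t "{0..1}" F])
          (auto intro!: derivative_eq_intros has_derivative_pd F)
      moreover have "pd (h *\<^sub>R e) F w = h *\<^sub>R pd e F w" for h w
        using has_derivative_pd[OF F[of w]]
        by (rule linear_cmul[OF bounded_linear.linear[OF has_derivative_bounded_linear]])
      ultimately show "((\<lambda>t. F (z + t *\<^sub>R e)) has_vector_derivative pd e F (z + t *\<^sub>R e))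
          (at t within {0..1})"
        by (simp add: has_vector_derivative_def)
    next
      show "continuous_on {0..1} (\<lambda>t. pd e F (z + t *\<^sub>R e))"
        by (rule continuous_on_compose2[OF c]) (auto intro!: continuous_intros)
    qed simp
    then show ?thesis by simp
  qed
  have "(LINT z|lborel. pd e F z) = (LINT t|lborel. (LINT z|lborel. ?h t z))"
    using shift[OF I'] by simp
  also have "\<dots> = (LINT z|lborel. (LINT t|lborel. ?h t z))"
    by (rule lborel_pair.Fubini_integral[OF FI, symmetric])
  also have "\<dots> = (LINT z|lborel. F (z + e) - F z)" by (simp add: ftc)
  also have "\<dots> = 0" using shift[OF I] shiftI[OF I] I by simp
  finally show ?thesis .
qed

section \<open>The Fourier transform of Schwartz functions\<close>

lemma norm_cis_taylor: "norm (cis x - 1 - \<i> * of_real x) \<le> x\<^sup>2 / 2"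
  using iexp_approx1[of x 1] by (simp add: cis_conv_exp power2_eq_square algebra_simps)

text \<open>Differentiation under the integral sign: the second-order remainder of the phase is at
  most \<open>(norm z)\<^sup>2 * (norm (y - \<zeta>))\<^sup>2 / 2\<close>, and rapid decay makes
  \<open>(norm z)\<^sup>2 * norm (f z)\<close> integrable, so the error is quadratic in
  \<open>y - \<zeta>\<close>.\<close>

lemma fourier_has_derivative:
  assumes f: "schwartz f"
  shows "(fourier f has_derivative (\<lambda>h. fourier (\<lambda>z. - \<i> * (of_real (z \<bullet> h) * f z)) \<zeta>)) (at \<zeta>)"
proof -
  have m[measurable]: "f \<in> borel_measurable borel" using schwartz_measurable[OF f] .
  have I: "integrable lborel (\<lambda>z. cis (- (z \<bullet> \<zeta>)) * f z)" for \<zeta>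
    by (intro integrable_cis_mult schwartz_integrable f) simp
  have R: "rapid (\<lambda>z. of_real (z \<bullet> h) * f z)" for h
    by (rule rapid_dominated[OF schwartz_rapid[OF f], of _ "norm h" 1])
      (auto simp: norm_mult intro!: mult_right_mono order_trans[OF Cauchy_Schwarz_ineq2],
        simp add: algebra_simps)
  have I1: "integrable lborel (\<lambda>z. cis (- (z \<bullet> \<zeta>)) * (- \<i> * (of_real (z \<bullet> h) * f z)))" for \<zeta> h
    by (intro integrable_cis_mult integrable_mult_right rapid_integrable R) measurable
  have R2: "rapid (\<lambda>z. of_real ((norm z)\<^sup>2) * f z)"
    by (rule rapid_dominated[OF schwartz_rapid[OF f], of _ 1 2])
      (auto simp: norm_mult norm_power intro!: mult_right_mono power_mono simp del: of_real_power)
  have I2: "integrable lborel (\<lambda>z. (norm z)\<^sup>2 * norm (f z))"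
    using integrable_norm[OF rapid_integrable[OF _ R2]] by (simp add: norm_mult norm_power)
  define M where "M = (LINT z|lborel. (norm z)\<^sup>2 * norm (f z)) / 2"
  let ?D = "\<lambda>h. fourier (\<lambda>z. - \<i> * (of_real (z \<bullet> h) * f z)) \<zeta>"
  have lin: "bounded_linear ?D"
  proof -
    have "linear ?D"
    proof (rule linearI)
      fix h k show "?D (h + k) = ?D h + ?D k"
        unfolding fourier_def Bochner_Integration.integral_add[OF I1 I1, symmetric]
        by (intro Bochner_Integration.integral_cong) (auto simp: inner_add_right algebra_simps)
    next
      fix c :: real and h
      have "?D (c *\<^sub>R h) = (LINT z|lborel. of_real c * (cis (- (z \<bullet> \<zeta>)) * (- \<i> * (of_real (z \<bullet> h) * f z))))"
        unfolding fourier_def by (intro Bochner_Integration.integral_cong) auto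
      then show "?D (c *\<^sub>R h) = c *\<^sub>R ?D h"
        unfolding fourier_def by (simp add: scaleR_conv_of_real)
    qed
    then show ?thesis by (rule linear_linear[THEN iffD2])
  qed
  show ?thesis
  proof (rule has_derivativeI_sandwich[where e=1 and H="\<lambda>y. norm (y - \<zeta>) * M"])
    fix y assume y: "y \<noteq> \<zeta>"
    let ?r = "\<lambda>z. cis (- (z \<bullet> \<zeta>)) * (cis (- (z \<bullet> (y - \<zeta>))) - 1 - \<i> * of_real (- (z \<bullet> (y - \<zeta>)))) * f z"
    have eq: "?r z = cis (- (z \<bullet> y)) * f z - cis (- (z \<bullet> \<zeta>)) * f z
        - cis (- (z \<bullet> \<zeta>)) * (- \<i> * (of_real (z \<bullet> (y - \<zeta>)) * f z))" for z
    proof -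
      have "cis (- (z \<bullet> y)) = cis (- (z \<bullet> \<zeta>)) * cis (- (z \<bullet> (y - \<zeta>)))"
        by (simp add: cis_mult inner_diff_right)
      then show ?thesis by (simp add: algebra_simps)
    qed
    have "fourier f y - fourier f \<zeta> - ?D (y - \<zeta>) = (LINT z|lborel. ?r z)"
      unfolding fourier_def eq using I I1 by simp
    also have "norm \<dots> \<le> (LINT z|lborel. (norm (y - \<zeta>))\<^sup>2 / 2 * ((norm z)\<^sup>2 * norm (f z)))"
    proof (rule Bochner_Integration.integral_norm_bound_integral)
      show "integrable lborel ?r" unfolding eq using I I1 by simp
      show "integrable lborel (\<lambda>z. (norm (y - \<zeta>))\<^sup>2 / 2 * ((norm z)\<^sup>2 * norm (f z)))"
        using I2 by simp
      fix z
      have "norm (cis (- (z \<bullet> (y - \<zeta>))) - 1 - \<i> * of_real (- (z \<bullet> (y - \<zeta>)))) \<le> (- (z \<bullet> (y - \<zeta>)))\<^sup>2 / 2"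
        by (rule norm_cis_taylor)
      also have "\<dots> \<le> (norm z * norm (y - \<zeta>))\<^sup>2 / 2"
        using Cauchy_Schwarz_ineq2[of z "y - \<zeta>"] by (simp add: abs_le_square_iff[symmetric] abs_mult)
      finally have "norm (?r z) \<le> (norm z * norm (y - \<zeta>))\<^sup>2 / 2 * norm (f z)"
        unfolding norm_mult norm_cis mult_1 by (rule mult_right_mono) simp
      then show "norm (?r z) \<le> (norm (y - \<zeta>))\<^sup>2 / 2 * ((norm z)\<^sup>2 * norm (f z))"
        by (simp add: power_mult_distrib algebra_simps)
    qed
    also have "\<dots> = (norm (y - \<zeta>))\<^sup>2 * M" by (simp add: M_def)
    finally have "norm (fourier f y - fourier f \<zeta> - ?D (y - \<zeta>)) \<le> (norm (y - \<zeta>))\<^sup>2 * M" .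
    then show "norm (fourier f y - fourier f \<zeta> - ?D (y - \<zeta>)) / norm (y - \<zeta>) \<le> norm (y - \<zeta>) * M"
      using y by (simp add: divide_le_eq power2_eq_square mult_ac)
  next
    show "((\<lambda>y. norm (y - \<zeta>) * M) \<longlongrightarrow> 0) (at \<zeta>)"
      by (auto intro!: tendsto_eq_intros)
  qed (use lin in auto)
qed

text \<open>Integration by parts: the derivative of the phase times \<open>f\<close> is a total
  derivative and integrates to 0.\<close>

lemma fourier_pd:
  assumes f: "schwartz f" and e: "e \<in> Basis"
  shows "fourier (pd e f) \<zeta> = \<i> * of_real (\<zeta> \<bullet> e) * fourier f \<zeta>"
proof -
  note [measurable] = schwartz_measurable[OF f] schwartz_measurable[OF schwartz_pd[OF f e]]
  let ?F = "\<lambda>z. cis (- (z \<bullet> \<zeta>)) * f z"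
  have D: "(?F has_derivative (\<lambda>d. cis (- (z \<bullet> \<zeta>)) * pd d f z
      + (of_real (- (d \<bullet> \<zeta>)) * (\<i> * cis (- (z \<bullet> \<zeta>)))) * f z)) (at z)" for z
    by (rule has_derivative_mult[OF _ has_derivative_pd[OF schwartz_differentiable[OF f]]])
      (auto intro!: derivative_eq_intros simp: scaleR_conv_of_real mult_ac fun_eq_iff)
  have pdF: "pd e ?F = (\<lambda>z. cis (- (z \<bullet> \<zeta>)) * pd e f z
      - \<i> * of_real (\<zeta> \<bullet> e) * (cis (- (z \<bullet> \<zeta>)) * f z))"
    using pd_eqI[OF D] by (auto simp: fun_eq_iff inner_commute)
  have I: "integrable lborel ?F" "integrable lborel (\<lambda>z. cis (- (z \<bullet> \<zeta>)) * pd e f z)"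
    by (intro integrable_cis_mult schwartz_integrable schwartz_pd f e; simp)+
  have "(LINT z|lborel. pd e ?F z) = 0"
  proof (rule integral_pd_eq_0)
    have "continuous_on UNIV f" "continuous_on UNIV (pd e f)"
      by (intro schwartz_continuous schwartz_pd f e)+
    then show "continuous_on UNIV (pd e ?F)" unfolding pdF unfolding cis_conv_exp
      by (intro continuous_intros)
    show "integrable lborel (pd e ?F)" unfolding pdF using I by simp
  qed (use D I in \<open>auto intro: differentiableI\<close>)
  then show ?thesis
    unfolding pdF fourier_def using I by simp
qed

section \<open>Stability of the Schwartz space under the Fourier transform\<close>

lemma norm_fourier_le:
  "norm (fourier f \<zeta>) \<le> (LINT z|lborel. norm (f z))"
  unfolding fourier_def using integral_norm_bound[of lborel "\<lambda>z. cis (- (z \<bullet> \<zeta>)) * f z"]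
  by (simp add: norm_mult)

lemma norm_le_Basis: "norm (z::plane) \<le> \<bar>z \<bullet> (1, 0)\<bar> + \<bar>z \<bullet> (0, 1)\<bar>"
proof -
  have "z = (z \<bullet> (1, 0), 0) + (0, z \<bullet> (0, 1))" by (cases z) auto
  then show ?thesis
    by (metis norm_Pair1 norm_Pair2 norm_triangle_ineq real_norm_def)
qed

lemma Basis_plane: "(1, 0) \<in> (Basis :: plane set)" "(0, 1) \<in> (Basis :: plane set)"
  by (simp_all add: Basis_prod_def)

text \<open>Each factor \<open>1 + norm z\<close> is traded for a derivative of \<open>f\<close> by
  \<open>fourier_pd\<close>; hence the induction on the power is for all \<open>f\<close> at
  once.\<close>

lemma rapid_fourier: "schwartz f \<Longrightarrow> rapid (fourier f)"
  unfolding rapid_def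
proof
  fix k
  assume "schwartz f"
  then show "\<exists>B. \<forall>z. (1 + norm z) ^ k * norm (fourier f z) \<le> B"
  proof (induction k arbitrary: f)
    case 0
    then show ?case using norm_fourier_le by auto
  next
    case (Suc k)
    obtain B0 where B0: "\<And>z. (1 + norm z) ^ k * norm (fourier f z) \<le> B0"
      using Suc by blast
    obtain B1 where B1: "\<And>z. (1 + norm z) ^ k * norm (fourier (pd (1, 0) f) z) \<le> B1"
      using Suc.IH[OF schwartz_pd[OF Suc.prems Basis_plane(1)]] by blast
    obtain B2 where B2: "\<And>z. (1 + norm z) ^ k * norm (fourier (pd (0, 1) f) z) \<le> B2"
      using Suc.IH[OF schwartz_pd[OF Suc.prems Basis_plane(2)]] by blast
    have "(1 + norm z) ^ Suc k * norm (fourier f z) \<le> B0 + B1 + B2" for z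
    proof -
      have "(1 + norm z) * norm (fourier f z)
          \<le> (1 + (\<bar>z \<bullet> (1, 0)\<bar> + \<bar>z \<bullet> (0, 1)\<bar>)) * norm (fourier f z)"
        by (intro mult_right_mono add_left_mono norm_le_Basis) auto
      also have "\<dots> = norm (fourier f z) + norm (fourier (pd (1, 0) f) z) + norm (fourier (pd (0, 1) f) z)"
        by (simp add: fourier_pd[OF Suc.prems] Basis_plane norm_mult algebra_simps)
      finally have "(1 + norm z) ^ k * ((1 + norm z) * norm (fourier f z))
          \<le> (1 + norm z) ^ k * \<dots>"
        by (intro mult_left_mono) auto
      also have "\<dots> \<le> B0 + B1 + B2"
        using B0[of z] B1[of z] B2[of z] by (simp add: algebra_simps)
      finally show ?thesis by (simp add: mult_ac)
    qed
    then show ?case by blast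
  qed
qed

text \<open>The transforms of Schwartz functions form a set to which
  \<open>schwartz_coinduct\<close> applies: a derivative of a transform is the transform of a
  coordinate multiple.\<close>

lemma schwartz_fourier: "schwartz f \<Longrightarrow> schwartz (fourier f)"
proof (rule schwartz_coinduct[of _ "fourier ` Collect schwartz"])
  fix g assume "g \<in> fourier ` Collect schwartz"
  then obtain f where f: "schwartz f" "g = fourier f" by auto
  have "pd e g = fourier (\<lambda>z. - \<i> * (of_real (z \<bullet> e) * f z))" for e
    using pd_eqI[OF fourier_has_derivative[OF f(1)]] f(2) by blast
  moreover have "schwartz (\<lambda>z. - \<i> * (of_real (z \<bullet> e) * f z))" if "e \<in> Basis" for e
    by (intro schwartz_scale schwartz_coord f that)
  moreover have "g differentiable (at \<zeta>)" for \<zeta>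
    unfolding f(2) by (rule differentiableI[OF fourier_has_derivative[OF f(1)]])
  ultimately show "(\<forall>z. g differentiable (at z)) \<and> rapid g \<and> (\<forall>e\<in>Basis. pd e g \<in> fourier ` Collect schwartz)"
    using rapid_fourier[OF f(1)] f(2) by blast
qed auto

section \<open>Gaussians and Fourier inversion\<close>

text \<open>The linear term \<open>b\<close> encodes the centre: up to a constant factor, the
  Gaussian centred at y is \<open>gauss \<kappa> b\<close> with b = 2 \<kappa> y.\<close>

definition gauss :: "real \<Rightarrow> plane \<Rightarrow> plane \<Rightarrow> complex" where
  "gauss \<kappa> b z = of_real (exp (b \<bullet> z - \<kappa> * (norm z)\<^sup>2))"

lemma gauss_measurable [measurable]: "gauss \<kappa> b \<in> borel_measurable borel"
  unfolding gauss_def[abs_def] by measurable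

lemma gauss_continuous: "continuous_on A (gauss \<kappa> b)"
  unfolding gauss_def[abs_def] by (intro continuous_intros)

lemma rapid_gauss:
  assumes "0 < \<kappa>"
  shows "rapid (gauss \<kappa> b)"
  unfolding rapid_def
proof
  fix k :: nat
  \<comment> \<open>With \<open>(1 + norm z) ^ k \<le> exp (k * norm z)\<close>, the exponent to
    bound is (k + |b|) x - \<kappa> x^2 at x = |z|, whose maximum is found by completing the
    square.\<close>
  let ?B = "exp ((k + norm b)\<^sup>2 / (4 * \<kappa>))"
  have "(1 + norm z) ^ k * norm (gauss \<kappa> b z) \<le> ?B" for z
  proof -
    have "(1 + norm z) ^ k \<le> exp (norm z) ^ k"
      by (intro power_mono) auto
    also have "\<dots> = exp (k * norm z)" by (simp add: exp_of_nat_mult)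
    finally have "(1 + norm z) ^ k * norm (gauss \<kappa> b z) \<le> exp (k * norm z) * exp (b \<bullet> z - \<kappa> * (norm z)\<^sup>2)"
      by (simp add: gauss_def)
    also have "\<dots> = exp (k * norm z + b \<bullet> z - \<kappa> * (norm z)\<^sup>2)"
      by (simp add: exp_add[symmetric] add_diff_eq)
    also have "\<dots> \<le> ?B"
    proof -
      have "b \<bullet> z \<le> norm b * norm z" using Cauchy_Schwarz_ineq2[of b z] by linarith
      moreover have "0 \<le> (2 * \<kappa> * norm z - (k + norm b))\<^sup>2 / (4 * \<kappa>)"
        using assms by simp
      moreover have "(2 * \<kappa> * norm z - (k + norm b))\<^sup>2 / (4 * \<kappa>)
          = \<kappa> * (norm z)\<^sup>2 - (k + norm b) * norm z + (k + norm b)\<^sup>2 / (4 * \<kappa>)"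
        using assms by (simp add: power2_eq_square field_simps)
      ultimately have "k * norm z + b \<bullet> z - \<kappa> * (norm z)\<^sup>2 \<le> (k + norm b)\<^sup>2 / (4 * \<kappa>)"
        by (simp add: algebra_simps)
      then show ?thesis by simp
    qed
    finally show ?thesis .
  qed
  then show "\<exists>B. \<forall>z. (1 + norm z) ^ k * norm (gauss \<kappa> b z) \<le> B" by blast
qed

lemma schwartz_gauss:
  assumes "0 < \<kappa>"
  shows "schwartz (gauss \<kappa> b)"
proof (rule schwartz_poly_span[of "{gauss \<kappa> b}"])
  fix g assume "g \<in> {gauss \<kappa> b}"
  then have g: "g = gauss \<kappa> b" by simp
  have D: "(gauss \<kappa> b has_derivative
      (\<lambda>h. of_real (b \<bullet> h) * gauss \<kappa> b z + of_real (- 2 * \<kappa>) * (of_real (z \<bullet> h) * gauss \<kappa> b z))) (at z)" for z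
    unfolding gauss_def[abs_def] power2_norm_eq_inner
    by (auto intro!: derivative_eq_intros simp: fun_eq_iff inner_commute algebra_simps)
  have "pd e (gauss \<kappa> b) = (\<lambda>z. of_real (b \<bullet> e) * gauss \<kappa> b z
      + of_real (- 2 * \<kappa>) * (of_real (z \<bullet> e) * gauss \<kappa> b z))" for e
    using pd_eqI[OF D] by blast
  moreover have "(\<lambda>z. of_real (b \<bullet> e) * gauss \<kappa> b z
      + of_real (- 2 * \<kappa>) * (of_real (z \<bullet> e) * gauss \<kappa> b z)) \<in> poly_span {gauss \<kappa> b}" if "e \<in> Basis" for e
    by (intro poly_span.add poly_span.scale poly_span.coord poly_span.base that) auto
  ultimately show "(\<forall>z. g differentiable (at z)) \<and> rapid g \<and> (\<forall>e\<in>Basis. pd e g \<in> poly_span {gauss \<kappa> b})"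
    unfolding g using rapid_gauss[OF assms] differentiableI[OF D] by metis
qed (auto intro: poly_span.base)

lemma integrable_gauss: "0 < \<kappa> \<Longrightarrow> integrable lborel (gauss \<kappa> b)"
  by (intro schwartz_integrable schwartz_gauss)

lemma integrable_gauss_real:
  assumes "0 < \<kappa>"
  shows "integrable lborel (\<lambda>x::real. complex_of_real (exp (- \<kappa> * x\<^sup>2)))"
proof -
  have "integrable lborel (\<lambda>x. sqrt (pi / \<kappa>) * normal_density 0 (sqrt (1 / (2 * \<kappa>))) x)"
    using assms by (intro integrable_mult_right integrable_normal_density) simp
  also have "(\<lambda>x. sqrt (pi / \<kappa>) * normal_density 0 (sqrt (1 / (2 * \<kappa>))) x) = (\<lambda>x. exp (- \<kappa> * x\<^sup>2))"
    using assms by (auto simp: normal_density_def fun_eq_iff real_sqrt_divide field_simps)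
  finally show ?thesis by (rule integrable_of_real)
qed

lemma integral_gauss_real:
  assumes \<kappa>: "0 < \<kappa>"
  shows "(LINT x|lborel. cis (t * x) * complex_of_real (exp (- \<kappa> * x\<^sup>2)))
    = of_real (sqrt (pi / \<kappa>) * exp (- t\<^sup>2 / (4 * \<kappa>)))"
proof -
  \<comment> \<open>Scaling by \<open>c\<close> turns the integrand into that of the characteristic
    function of the standard normal distribution, evaluated at \<open>t / c\<close>.\<close>
  define c where "c = sqrt (2 * \<kappa>)"
  have c: "0 < c" "c\<^sup>2 = 2 * \<kappa>" using \<kappa> by (auto simp: c_def)
  let ?f = "\<lambda>x. cis (t / c * x) * complex_of_real (exp (- x\<^sup>2 / 2))"
  have "char std_normal_distribution (t / c) = (LINT x|lborel. std_normal_density x *\<^sub>R iexp (t / c * x))"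
    unfolding char_def by (subst integral_density) auto
  also have "\<dots> = (LINT x|lborel. of_real (1 / sqrt (2 * pi)) * ?f x)"
    by (intro Bochner_Integration.integral_cong)
      (auto simp: std_normal_density_def cis_conv_exp scaleR_conv_of_real mult_ac)
  finally have "(LINT x|lborel. of_real (1 / sqrt (2 * pi)) * ?f x) = of_real (exp (- (t / c)\<^sup>2 / 2))"
    unfolding char_std_normal_distribution by simp
  then have "(LINT x|lborel. ?f x) = of_real (sqrt (2 * pi) * exp (- (t / c)\<^sup>2 / 2))"
    by (simp add: field_simps)
  moreover have "(LINT x|lborel. ?f x) = c *\<^sub>R (LINT x|lborel. ?f (c * x))"
    using lborel_integral_affine[of ?f c 0] c by simp
  moreover have "?f (c * x) = cis (t * x) * complex_of_real (exp (- \<kappa> * x\<^sup>2))" for x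
    using c by (simp add: power_mult_distrib)
  ultimately have *: "c *\<^sub>R (LINT x|lborel. cis (t * x) * complex_of_real (exp (- \<kappa> * x\<^sup>2)))
      = of_real (sqrt (2 * pi) * exp (- (t / c)\<^sup>2 / 2))" by simp
  have "(LINT x|lborel. cis (t * x) * complex_of_real (exp (- \<kappa> * x\<^sup>2)))
      = inverse c *\<^sub>R of_real (sqrt (2 * pi) * exp (- (t / c)\<^sup>2 / 2))"
    unfolding *[symmetric] using c(1) by simp
  also have "\<dots> = of_real (inverse c * sqrt (2 * pi) * exp (- (t / c)\<^sup>2 / 2))"
    by (simp add: scaleR_conv_of_real)
  also have "inverse c * sqrt (2 * pi) = sqrt (pi / \<kappa>)"
    by (simp add: c_def real_sqrt_mult real_sqrt_divide field_simps)
  also have "- (t / c)\<^sup>2 / 2 = - t\<^sup>2 / (4 * \<kappa>)"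
    using c by (simp add: power_divide)
  finally show ?thesis .
qed

lemma integral_gauss:
  assumes \<kappa>: "0 < \<kappa>"
  shows "(LINT z|lborel. cis (z \<bullet> \<zeta>) * gauss \<kappa> 0 z) = of_real (pi / \<kappa> * exp (- (norm \<zeta>)\<^sup>2 / (4 * \<kappa>)))"
proof -
  let ?f = "\<lambda>t x. cis (t * x) * complex_of_real (exp (- \<kappa> * x\<^sup>2))"
  have I: "integrable lborel (?f t)" for t
    by (intro integrable_cis_mult integrable_gauss_real \<kappa>) simp
  have "cis (z \<bullet> \<zeta>) * gauss \<kappa> 0 z = ?f (fst \<zeta>) (fst z) * ?f (snd \<zeta>) (snd z)" for z
    by (simp add: gauss_def norm_plane inner_prod_def cis_mult[symmetric] distrib_left diff_diff_eq[symmetric]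
      exp_diff exp_minus mult_ac) (simp add: exp_add divide_inverse mult_ac)
  then have "(LINT z|lborel. cis (z \<bullet> \<zeta>) * gauss \<kappa> 0 z)
      = (LINT x|lborel. ?f (fst \<zeta>) x) * (LINT x|lborel. ?f (snd \<zeta>) x)"
    using integral_times_prod(2)[OF I I] by simp
  also have "\<dots> = of_real ((sqrt (pi / \<kappa>) * sqrt (pi / \<kappa>)) *
      (exp (- (fst \<zeta>)\<^sup>2 / (4 * \<kappa>)) * exp (- (snd \<zeta>)\<^sup>2 / (4 * \<kappa>))))"
    unfolding integral_gauss_real[OF \<kappa>] by (simp del: real_sqrt_mult_self add: mult_ac)
  also have "sqrt (pi / \<kappa>) * sqrt (pi / \<kappa>) = pi / \<kappa>" using \<kappa> by simp
  also have "exp (- (fst \<zeta>)\<^sup>2 / (4 * \<kappa>)) * exp (- (snd \<zeta>)\<^sup>2 / (4 * \<kappa>)) = exp (- (norm \<zeta>)\<^sup>2 / (4 * \<kappa>))"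
    by (simp add: exp_add[symmetric] norm_plane add_divide_distrib diff_divide_distrib)
  finally show ?thesis .
qed

text \<open>The factor \<open>pi\<close> is the mass of the unnormalized Gaussian
  \<open>gauss 1 0\<close>. Boundedness of \<open>f\<close> supplies the dominating
  function.\<close>

lemma approximate_identity:
  assumes [measurable]: "f \<in> borel_measurable borel" and c: "isCont f z"
    and B: "\<And>w. norm (f w) \<le> B" and X: "X \<longlonglongrightarrow> 0"
  shows "(\<lambda>n. LINT w|lborel. f (z + X n *\<^sub>R w) * gauss 1 0 w) \<longlonglongrightarrow> of_real pi * f z"
proof -
  have "(\<lambda>n. LINT w|lborel. f (z + X n *\<^sub>R w) * gauss 1 0 w) \<longlonglongrightarrow> (LINT w|lborel. f z * gauss 1 0 w)"
  proof (rule integral_dominated_convergence[where w="\<lambda>w. B * norm (gauss 1 0 w)"])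
    have "(\<lambda>n. z + X n *\<^sub>R w) \<longlonglongrightarrow> z" for w
      using tendsto_add[OF tendsto_const tendsto_scaleR[OF X tendsto_const]] by simp
    then have "(\<lambda>n. f (z + X n *\<^sub>R w)) \<longlonglongrightarrow> f z" for w
      using isCont_tendsto_compose[OF c] by blast
    then show "AE w in lborel. (\<lambda>n. f (z + X n *\<^sub>R w) * gauss 1 0 w) \<longlonglongrightarrow> f z * gauss 1 0 w"
      by (intro always_eventually allI tendsto_mult tendsto_const)
    show "AE w in lborel. norm (f (z + X n *\<^sub>R w) * gauss 1 0 w) \<le> B * norm (gauss 1 0 w)" for n
      by (simp add: norm_mult mult_right_mono B)
    show "integrable lborel (\<lambda>w. B * norm (gauss 1 0 w))"
      using integrable_gauss[of 1 0] by simp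
  qed measurable
  also have "(LINT w|lborel. f z * gauss 1 0 w) = of_real pi * f z"
    using integral_gauss[of 1 0] by simp
  finally show ?thesis .
qed

lemma gauss_change_of_variables:
  assumes [measurable]: "f \<in> borel_measurable borel" and \<epsilon>: "\<epsilon> \<noteq> 0"
  shows "(LINT w|lborel. f w * of_real (exp (- (norm (z - w))\<^sup>2 / \<epsilon>\<^sup>2)))
    = of_real (\<epsilon>\<^sup>2) * (LINT w|lborel. f (z + \<epsilon> *\<^sub>R w) * gauss 1 0 w)"
proof -
  have "(LINT w|lborel. f w * of_real (exp (- (norm (z - w))\<^sup>2 / \<epsilon>\<^sup>2)))
      = \<bar>\<epsilon>\<bar> ^ DIM(plane) *\<^sub>R (LINT w|lborel. f (z + \<epsilon> *\<^sub>R w) *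
          of_real (exp (- (norm (z - (z + \<epsilon> *\<^sub>R w)))\<^sup>2 / \<epsilon>\<^sup>2)))"
    by (rule lborel_integral_affine) (use \<epsilon> in auto)
  also have "\<dots> = of_real (\<epsilon>\<^sup>2) * (LINT w|lborel. f (z + \<epsilon> *\<^sub>R w) * gauss 1 0 w)"
    using \<epsilon> by (simp add: gauss_def power_mult_distrib scaleR_conv_of_real flip: power2_eq_square)
  finally show ?thesis .
qed

lemma integrable_kernel:
  fixes f :: "'a::euclidean_space \<Rightarrow> complex" and g :: "'b::euclidean_space \<Rightarrow> complex"
  assumes f: "integrable lborel f" and g: "integrable lborel g"
    and k: "case_prod k \<in> borel_measurable (lborel \<Otimes>\<^sub>M lborel)" and B: "\<And>x y. norm (k x y) \<le> B"
  shows "integrable (lborel \<Otimes>\<^sub>M lborel) (\<lambda>(x, y). k x y * (f x * g y))"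
proof -
  have "integrable (lborel \<Otimes>\<^sub>M lborel) (\<lambda>z. f (fst z) * g (snd z))"
    by (rule lborel_pair.Fubini_integrable) (use f g in \<open>auto simp: norm_mult\<close>)
  then have "integrable (lborel \<Otimes>\<^sub>M lborel) (\<lambda>z. case_prod k z * (f (fst z) * g (snd z)))"
    by (rule integrable_bounded_mult[OF _ k, where B=B]) (auto simp: B split: prod.split)
  then show ?thesis by (simp add: case_prod_beta')
qed

text \<open>Written out, \<open>inv_fourier (fourier f) z\<close> is an iterated integral without
  absolute convergence in both variables. A Gaussian factor in the frequency makes Fubini available
  and turns the inner integral into an approximate identity; dominated convergence then removes the
  factor.\<close>

lemma fourier_inversion:
  assumes f: "schwartz f"
  shows "inv_fourier (fourier f) z = f z"
proof -
  note [measurable] = schwartz_measurable[OF f] schwartz_measurable[OF schwartz_fourier[OF f]]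
  define X where "X n = inverse (real (Suc n))" for n
  have X: "X \<longlonglongrightarrow> 0" "X n > 0" for n
    unfolding X_def[abs_def] by (rule LIMSEQ_inverse_real_of_nat) simp
  obtain B where B: "\<And>w. norm (f w) \<le> B" using schwartz_bounded[OF f] by blast
  \<comment> \<open>The width \<open>(X n)\<^sup>2 / 4\<close> has as its transform a Gaussian in
    \<open>z - w\<close> of scale exactly \<open>X n\<close>. The limit carries the factor
    \<open>4 * pi * pi\<close>, which is the normalization \<open>(2 * pi)\<^sup>2\<close> of
    \<open>inv_fourier\<close>.\<close>
  let ?J = "\<lambda>n. LINT \<zeta>|lborel. gauss ((X n)\<^sup>2 / 4) 0 \<zeta> * (cis (z \<bullet> \<zeta>) * fourier f \<zeta>)"
  have J: "?J n = 4 * of_real pi * (LINT w|lborel. f (z + X n *\<^sub>R w) * gauss 1 0 w)" for n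
  proof -
    let ?\<kappa> = "(X n)\<^sup>2 / 4"
    have \<kappa>: "0 < ?\<kappa>" using X(2)[of n] by simp
    have I: "integrable (lborel \<Otimes>\<^sub>M lborel)
        (\<lambda>(\<zeta>, w). cis ((z - w) \<bullet> \<zeta>) * (gauss ?\<kappa> 0 \<zeta> * f w))"
      by (rule integrable_kernel[where B=1]) (use schwartz_integrable[OF f] integrable_gauss[OF \<kappa>] in auto)
    have "?J n = (LINT \<zeta>|lborel. (LINT w|lborel. cis ((z - w) \<bullet> \<zeta>) * (gauss ?\<kappa> 0 \<zeta> * f w)))"
    proof (rule Bochner_Integration.integral_cong[OF refl])
      fix \<zeta>
      have "gauss ?\<kappa> 0 \<zeta> * (cis (z \<bullet> \<zeta>) * fourier f \<zeta>)
          = (LINT w|lborel. gauss ?\<kappa> 0 \<zeta> * cis (z \<bullet> \<zeta>) * (cis (- (w \<bullet> \<zeta>)) * f w))"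
        unfolding fourier_def by simp
      also have "\<dots> = (LINT w|lborel. cis ((z - w) \<bullet> \<zeta>) * (gauss ?\<kappa> 0 \<zeta> * f w))"
      proof (rule Bochner_Integration.integral_cong[OF refl])
        fix w
        have "cis ((z - w) \<bullet> \<zeta>) = cis (z \<bullet> \<zeta>) * cis (- (w \<bullet> \<zeta>))"
          by (simp add: cis_mult inner_diff_left)
        then show "gauss ?\<kappa> 0 \<zeta> * cis (z \<bullet> \<zeta>) * (cis (- (w \<bullet> \<zeta>)) * f w)
            = cis ((z - w) \<bullet> \<zeta>) * (gauss ?\<kappa> 0 \<zeta> * f w)" by simp
      qed
      finally show "gauss ?\<kappa> 0 \<zeta> * (cis (z \<bullet> \<zeta>) * fourier f \<zeta>)
          = (LINT w|lborel. cis ((z - w) \<bullet> \<zeta>) * (gauss ?\<kappa> 0 \<zeta> * f w))" .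
    qed
    also have "\<dots> = (LINT w|lborel. (LINT \<zeta>|lborel. cis ((z - w) \<bullet> \<zeta>) * (gauss ?\<kappa> 0 \<zeta> * f w)))"
      by (rule lborel_pair.Fubini_integral[OF I, symmetric])
    also have "\<dots> = (LINT w|lborel. of_real (4 * pi / (X n)\<^sup>2) * (f w * of_real (exp (- (norm (z - w))\<^sup>2 / (X n)\<^sup>2))))"
    proof (rule Bochner_Integration.integral_cong[OF refl])
      fix w
      have "(LINT \<zeta>|lborel. cis ((z - w) \<bullet> \<zeta>) * (gauss ?\<kappa> 0 \<zeta> * f w))
          = f w * (LINT \<zeta>|lborel. cis (\<zeta> \<bullet> (z - w)) * gauss ?\<kappa> 0 \<zeta>)"
        unfolding integral_mult_right_zero[symmetric]
        by (intro Bochner_Integration.integral_cong) (simp_all add: mult_ac inner_commute)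
      also have "\<dots> = of_real (4 * pi / (X n)\<^sup>2) * (f w * of_real (exp (- (norm (z - w))\<^sup>2 / (X n)\<^sup>2)))"
        unfolding integral_gauss[OF \<kappa>] by simp
      finally show "(LINT \<zeta>|lborel. cis ((z - w) \<bullet> \<zeta>) * (gauss ?\<kappa> 0 \<zeta> * f w))
          = of_real (4 * pi / (X n)\<^sup>2) * (f w * of_real (exp (- (norm (z - w))\<^sup>2 / (X n)\<^sup>2)))" .
    qed
    also have "\<dots> = of_real (4 * pi / (X n)\<^sup>2) * (of_real ((X n)\<^sup>2) *
        (LINT w|lborel. f (z + X n *\<^sub>R w) * gauss 1 0 w))"
      using X(2)[of n] by (subst integral_mult_right_zero, subst gauss_change_of_variables) auto
    also have "\<dots> = 4 * of_real pi * (LINT w|lborel. f (z + X n *\<^sub>R w) * gauss 1 0 w)"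
      using X(2)[of n] by simp
    finally show ?thesis .
  qed
  have "?J \<longlonglongrightarrow> 4 * of_real pi * (of_real pi * f z)"
    unfolding J
    by (intro tendsto_mult tendsto_const approximate_identity[OF _ _ B X(1)])
      (use schwartz_continuous[OF f, of UNIV] in \<open>auto simp: continuous_on_eq_continuous_at simp del: split_paired_All\<close>)
  moreover have "?J \<longlonglongrightarrow> (LINT \<zeta>|lborel. cis (z \<bullet> \<zeta>) * fourier f \<zeta>)"
  proof (rule integral_dominated_convergence[where w="\<lambda>\<zeta>. norm (fourier f \<zeta>)"])
    have "(\<lambda>n. gauss ((X n)\<^sup>2 / 4) 0 \<zeta>) \<longlonglongrightarrow> 1" for \<zeta>
    proof -
      have "(\<lambda>n. complex_of_real (exp (0 - (X n)\<^sup>2 / 4 * (norm \<zeta>)\<^sup>2)))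
          \<longlonglongrightarrow> of_real (exp (0 - 0\<^sup>2 / 4 * (norm \<zeta>)\<^sup>2))"
        by (intro tendsto_intros X)  simp
      then show ?thesis by (simp add: gauss_def)
    qed
    then have "(\<lambda>n. gauss ((X n)\<^sup>2 / 4) 0 \<zeta> * (cis (z \<bullet> \<zeta>) * fourier f \<zeta>))
        \<longlonglongrightarrow> 1 * (cis (z \<bullet> \<zeta>) * fourier f \<zeta>)" for \<zeta>
      by (intro tendsto_mult tendsto_const)
    then show "AE \<zeta> in lborel. (\<lambda>n. gauss ((X n)\<^sup>2 / 4) 0 \<zeta> * (cis (z \<bullet> \<zeta>) * fourier f \<zeta>))
        \<longlonglongrightarrow> cis (z \<bullet> \<zeta>) * fourier f \<zeta>" by simp
    show "AE \<zeta> in lborel. norm (gauss ((X n)\<^sup>2 / 4) 0 \<zeta> * (cis (z \<bullet> \<zeta>) * fourier f \<zeta>))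
        \<le> norm (fourier f \<zeta>)" for n
      by (auto simp: norm_mult gauss_def intro!: mult_left_le_one_le)
    show "integrable lborel (\<lambda>\<zeta>. norm (fourier f \<zeta>))"
      by (intro integrable_norm schwartz_integrable schwartz_fourier f)
  qed measurable
  ultimately have "(LINT \<zeta>|lborel. cis (z \<bullet> \<zeta>) * fourier f \<zeta>) = 4 * of_real pi * (of_real pi * f z)"
    by (rule LIMSEQ_unique[rotated])
  then show ?thesis
    by (simp add: inv_fourier_def power2_eq_square)
qed

lemma inv_fourier_eq: "inv_fourier f z = of_real (1 / (2 * pi)\<^sup>2) * fourier f (- z)"
  by (simp add: inv_fourier_def fourier_def inner_commute)

section \<open>Uniqueness of Fourier transforms that are functions\<close>

text \<open>Testing against Gaussians centred at every point makes all Gaussian mollifications of \<open>F\<close> vanish.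
  The extra Gaussian factors make the functions integrable.\<close>

lemma AE_eq_0_schwartz:
  assumes F: "F \<in> borel_measurable borel"
    and I: "\<And>h. schwartz h \<Longrightarrow> integrable lborel (\<lambda>\<zeta>. F \<zeta> * h \<zeta>)"
    and zero: "\<And>h. schwartz h \<Longrightarrow> (LINT \<zeta>|lborel. F \<zeta> * h \<zeta>) = 0"
  shows "AE \<zeta> in lborel. F \<zeta> = 0"
proof -
  note [measurable] = F
  \<comment> \<open>Only products of \<open>F\<close> with Schwartz functions are known to be
    integrable, hence the first Gaussian.\<close>
  define K where "K \<zeta> = F \<zeta> * gauss 1 0 \<zeta>" for \<zeta>
  have K: "integrable lborel K" unfolding K_def[abs_def] by (intro I schwartz_gauss) simp
  then have [measurable]: "K \<in> borel_measurable borel" by auto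
  define X where "X n = inverse (real (Suc n))" for n
  have X: "X \<longlonglongrightarrow> 0" "X n > 0" for n
    unfolding X_def[abs_def] by (rule LIMSEQ_inverse_real_of_nat) simp
  have gB: "norm (gauss 1 0 w) \<le> 1" for w by (simp add: gauss_def)
  have K_cont: "(LINT x|lborel. \<psi> x * (K x * gauss 1 0 x)) = 0"
    if \<psi>: "continuous_on UNIV \<psi>" "\<And>x. norm (\<psi> x) \<le> 1" for \<psi>
  proof -
    have [measurable]: "\<psi> \<in> borel_measurable borel" using \<psi> by (intro borel_measurable_continuous_onI)
    \<comment> \<open>The second Gaussian makes the test function integrable as well, so that Fubini
      applies to the mollification.\<close>
    define \<Psi> where "\<Psi> x = \<psi> x * gauss 1 0 x" for x
    have [measurable]: "\<Psi> \<in> borel_measurable borel" unfolding \<Psi>_def[abs_def] by measurable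
    have \<Psi>: "integrable lborel \<Psi>" "\<And>x. norm (\<Psi> x) \<le> 1" "continuous_on UNIV \<Psi>"
      unfolding \<Psi>_def using \<psi> gB
      by (auto intro!: integrable_bounded_mult integrable_gauss continuous_on_mult gauss_continuous
        mult_le_one simp: norm_mult)
    let ?S = "\<lambda>n x. LINT w|lborel. \<Psi> (x + X n *\<^sub>R w) * gauss 1 0 w"
    have 0: "(LINT x|lborel. K x * ?S n x) = 0" for n
    proof -
      have FI: "integrable (lborel \<Otimes>\<^sub>M lborel)
          (\<lambda>(x, y). of_real (exp (- (norm (x - y))\<^sup>2 / (X n)\<^sup>2)) * (K x * \<Psi> y))"
        by (rule integrable_kernel[OF K \<Psi>(1), where B=1]) auto
      have "of_real ((X n)\<^sup>2) * (LINT x|lborel. K x * ?S n x)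
          = (LINT x|lborel. K x * (of_real ((X n)\<^sup>2) * ?S n x))"
        unfolding integral_mult_right_zero[symmetric]
        by (intro Bochner_Integration.integral_cong) (simp_all add: mult_ac)
      also have "\<dots> = (LINT x|lborel. K x * (LINT y|lborel. \<Psi> y * of_real (exp (- (norm (x - y))\<^sup>2 / (X n)\<^sup>2))))"
        using X(2)[of n] by (subst gauss_change_of_variables) auto
      also have "\<dots> = (LINT x|lborel. (LINT y|lborel. of_real (exp (- (norm (x - y))\<^sup>2 / (X n)\<^sup>2)) * (K x * \<Psi> y)))"
        unfolding integral_mult_right_zero[symmetric]
        by (intro Bochner_Integration.integral_cong) (simp_all add: mult_ac)
      also have "\<dots> = (LINT y|lborel. (LINT x|lborel. of_real (exp (- (norm (x - y))\<^sup>2 / (X n)\<^sup>2)) * (K x * \<Psi> y)))"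
        by (rule lborel_pair.Fubini_integral[OF FI, symmetric])
      also have "\<dots> = (LINT y|(lborel :: plane measure). 0)"
      proof (rule Bochner_Integration.integral_cong[OF refl])
        fix y :: plane
        have pos: "0 < 1 + 1 / (X n)\<^sup>2" by (intro add_pos_nonneg) auto
        \<comment> \<open>For fixed \<open>y\<close>, the mollifying kernel and the Gaussian inside
          \<open>K\<close> combine to a constant times a Gaussian in \<open>x\<close> with shifted
          centre. This is a Schwartz function, so the hypothesis \<open>zero\<close>
          applies.\<close>
        have eq: "of_real (exp (- (norm (x - y))\<^sup>2 / (X n)\<^sup>2)) * (K x * \<Psi> y)
            = (\<Psi> y * of_real (exp (- (norm y)\<^sup>2 / (X n)\<^sup>2))) *
              (F x * gauss (1 + 1 / (X n)\<^sup>2) ((2 / (X n)\<^sup>2) *\<^sub>R y) x)" for x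
        proof -
          have "exp (- (norm (x - y))\<^sup>2 / (X n)\<^sup>2) * exp (- (norm x)\<^sup>2)
              = exp (- (norm y)\<^sup>2 / (X n)\<^sup>2) *
                exp ((2 / (X n)\<^sup>2) *\<^sub>R y \<bullet> x - (1 + 1 / (X n)\<^sup>2) * (norm x)\<^sup>2)"
            unfolding exp_add[symmetric] power2_norm_eq_inner
            by (simp add: inner_diff_left inner_diff_right inner_commute field_simps diff_divide_distrib add_divide_distrib)
          then show ?thesis
            unfolding K_def gauss_def by (simp flip: of_real_mult add: mult_ac)
        qed
        show "(LINT x|lborel. of_real (exp (- (norm (x - y))\<^sup>2 / (X n)\<^sup>2)) * (K x * \<Psi> y)) = 0"
          unfolding eq integral_mult_right_zero zero[OF schwartz_gauss[OF pos]] by simp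
      qed
      finally show ?thesis using X(2)[of n] by simp
    qed
    have "(\<lambda>n. LINT x|lborel. K x * ?S n x) \<longlonglongrightarrow> (LINT x|lborel. K x * (of_real pi * \<Psi> x))"
    proof (rule integral_dominated_convergence[where w="\<lambda>x. norm (K x) * pi"])
      have "(\<lambda>n. ?S n x) \<longlonglongrightarrow> of_real pi * \<Psi> x" for x
        by (rule approximate_identity[OF _ _ \<Psi>(2) X(1)])
          (use \<Psi>(3) in \<open>auto simp: continuous_on_eq_continuous_at simp del: split_paired_All\<close>)
      then show "AE x in lborel. (\<lambda>n. K x * ?S n x) \<longlonglongrightarrow> K x * (of_real pi * \<Psi> x)"
        by (intro always_eventually allI tendsto_mult tendsto_const)
      have "norm (?S n x) \<le> pi" for n x
      proof -
        have "norm (?S n x) \<le> (LINT w|lborel. norm (gauss 1 0 w))"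
        proof (rule Bochner_Integration.integral_norm_bound_integral)
          show "integrable lborel (\<lambda>w. \<Psi> (x + X n *\<^sub>R w) * gauss 1 0 w)"
            by (rule integrable_bounded_mult[where B=1]) (auto intro!: integrable_gauss \<Psi>(2))
          show "norm (\<Psi> (x + X n *\<^sub>R w) * gauss 1 0 w) \<le> norm (gauss 1 0 w)" for w
            using \<Psi>(2) by (simp add: norm_mult mult_left_le_one_le)
        qed (auto intro!: integrable_norm integrable_gauss)
        also have "(LINT w|lborel. norm (gauss 1 0 w)) = pi"
        proof -
          have "complex_of_real (LINT w|lborel. norm (gauss 1 0 w)) = (LINT w|lborel. cis (w \<bullet> 0) * gauss 1 0 w)"
            by (simp add: gauss_def)
          also have "\<dots> = of_real pi" by (subst integral_gauss) auto
          finally show ?thesis using of_real_eq_iff by blast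
        qed
        finally show ?thesis .
      qed
      then show "AE x in lborel. norm (K x * ?S n x) \<le> norm (K x) * pi" for n
        by (auto simp: norm_mult intro!: mult_left_mono)
    qed (use K in auto)
    then have "(LINT x|lborel. of_real pi * (\<psi> x * (K x * gauss 1 0 x))) = 0"
      unfolding 0 LIMSEQ_const_iff by (simp add: \<Psi>_def mult_ac)
    then show ?thesis by simp
  qed
  define L where "L x = K x * gauss 1 0 x" for x
  have L: "integrable lborel L"
    using integrable_bounded_mult[OF K, of "gauss 1 0" 1] gB by (simp add: L_def[abs_def] mult.commute)
  then have [measurable]: "L \<in> borel_measurable borel" by auto
  have L_open: "set_lebesgue_integral lborel U L = 0" if U: "open U" for U
  \<comment> \<open>\<open>infdist\<close> to the empty complement is 0 by convention, so the
    cut-offs used for the other open sets would vanish identically.\<close>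
  proof (cases "U = UNIV")
    case True
    then show ?thesis using K_cont[of "\<lambda>_. 1"] by (simp add: set_lebesgue_integral_def L_def)
  next
    case False
    \<comment> \<open>Continuous cut-offs that increase to the indicator of
      \<open>U\<close>.\<close>
    let ?\<psi> = "\<lambda>m x. min 1 (real m * infdist x (- U))"
    have "(\<lambda>m. LINT x|lborel. of_real (?\<psi> m x) * L x) \<longlonglongrightarrow> (LINT x|lborel. indicator U x *\<^sub>R L x)"
    proof (rule integral_dominated_convergence[where w="\<lambda>x. norm (L x)"])
      have "(\<lambda>m. complex_of_real (?\<psi> m x)) \<longlonglongrightarrow> indicator U x" for x
      proof (cases "x \<in> U")
        case True
        then have "0 < infdist x (- U)"
          using infdist_pos_not_in_closed[of "- U" x] U False by auto
        then have "filterlim (\<lambda>m. infdist x (- U) * real m) at_top sequentially"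
          by (intro filterlim_tendsto_pos_mult_at_top[OF tendsto_const _ filterlim_real_sequentially])
        then have "\<forall>\<^sub>F m in sequentially. 1 \<le> infdist x (- U) * real m"
          by (simp add: filterlim_at_top)
        then have "\<forall>\<^sub>F m in sequentially. complex_of_real (?\<psi> m x) = 1"
          by eventually_elim (simp add: min_def mult.commute)
        then show ?thesis using True by (simp add: tendsto_eventually)
      next
        case False
        then show ?thesis by simp
      qed
      then have "(\<lambda>m. of_real (?\<psi> m x) * L x) \<longlonglongrightarrow> indicator U x * L x" for x
        by (intro tendsto_mult tendsto_const)
      then show "AE x in lborel. (\<lambda>m. of_real (?\<psi> m x) * L x) \<longlonglongrightarrow> indicator U x *\<^sub>R L x"
        by (simp add: scaleR_conv_of_real of_real_indicator)
      show "AE x in lborel. norm (of_real (?\<psi> m x) * L x) \<le> norm (L x)" for m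
        by (intro always_eventually allI, unfold norm_mult, rule mult_left_le_one_le)
          (simp_all add: infdist_nonneg)
      show "(\<lambda>x. of_real (?\<psi> m x) * L x) \<in> borel_measurable lborel" for m
      proof -
        have "(\<lambda>x. of_real (?\<psi> m x) :: complex) \<in> borel_measurable borel"
          by (intro borel_measurable_continuous_onI continuous_intros)
        then show ?thesis by measurable
      qed
    qed (use L U in auto)
    moreover have "(LINT x|lborel. of_real (?\<psi> m x) * L x) = 0" for m
      unfolding L_def
      by (rule K_cont) (intro continuous_intros, simp add: infdist_nonneg)
    ultimately show ?thesis
      unfolding set_lebesgue_integral_def by (simp add: LIMSEQ_const_iff)
  qed
  \<comment> \<open>Dynkin's argument: the open sets are stable under intersection and generate the
    Borel sets.\<close>
  have "set_lebesgue_integral lborel A L = 0" if "A \<in> sets lborel" for A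
  proof -
    have LA: "set_integrable lborel A L" if "A \<in> sets borel" for A
      unfolding set_integrable_def using L that by (intro integrable_mult_indicator) auto
    have sets: "sigma_sets UNIV {S. open S} = sets (borel :: plane measure)"
      by (simp add: borel_def)
    have "Int_stable {S::plane set. open S}" "{S::plane set. open S} \<subseteq> Pow UNIV"
      by (auto simp: Int_stable_def)
    moreover have "A \<in> sigma_sets UNIV {S. open S}" using that by (simp add: borel_def)
    ultimately show ?thesis
    proof (induction rule: sigma_sets_induct_disjoint)
      case (compl A)
      then have A: "A \<in> sets borel" using sets by auto
      have "set_lebesgue_integral lborel UNIV L
          = set_lebesgue_integral lborel A L + set_lebesgue_integral lborel (UNIV - A) L"
        using set_integral_Un[of A "UNIV - A" lborel L] LA A by (auto simp: Un_absorb1)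
      then show ?case using L_open[of UNIV] compl by simp
    next
      case (union A)
      then have A: "A i \<in> sets borel" for i using sets by auto
      have "(LINT x:(\<Union>i. A i)|lborel. L x) = (\<Sum>i. (LINT x:(A i)|lborel. L x))"
        using union.hyps A LA by (intro lebesgue_integral_countable_add) (auto simp: disjoint_family_on_def)
      then show ?case using union by simp
    qed (auto simp: L_open)
  qed
  then have "AE x in lborel. L x = 0"
    by (intro sigma_finite_measure.density_zero[OF sigma_finite_lborel] L)
  then show ?thesis
    by eventually_elim (auto simp: L_def K_def gauss_def)
qed

section \<open>Distributions whose Fourier transform is integrable\<close>

lemma has_fourier_fun_unique:
  assumes "has_fourier_fun u g" "has_fourier_fun u g'"
  shows "AE \<zeta> in lborel. g \<zeta> = g' \<zeta>"
proof -
  have "AE \<zeta> in lborel. g \<zeta> - g' \<zeta> = 0"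
    by (rule AE_eq_0_schwartz) (use assms in \<open>auto simp: has_fourier_fun_def left_diff_distrib\<close>)
  then show ?thesis by simp
qed

lemma has_fourier_fun_fourier_fun: "has_fourier_fun u g \<Longrightarrow> has_fourier_fun u (fourier_fun u)"
  unfolding fourier_fun_def using someI[of "has_fourier_fun u" g] by simp

text \<open>Neutralizes the choice in \<open>fourier_fun\<close>: every later integral may be
  computed with an explicit transform.\<close>

lemma AE_fourier_fun: "has_fourier_fun u g \<Longrightarrow> AE \<zeta> in lborel. fourier_fun u \<zeta> = g \<zeta>"
  using has_fourier_fun_unique has_fourier_fun_fourier_fun by blast

lemma has_fourier_fun_measurable: "has_fourier_fun u g \<Longrightarrow> g \<in> borel_measurable borel"
  by (simp add: has_fourier_fun_def)

lemma inv_fourier_measurable [measurable (raw)]: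
  assumes [measurable]: "f \<in> borel_measurable borel"
  shows "inv_fourier f \<in> borel_measurable borel"
  unfolding inv_fourier_def[abs_def] by measurable

lemma norm_inv_fourier_le: "norm (inv_fourier f \<zeta>) \<le> (LINT z|lborel. norm (f z)) / (2 * pi)\<^sup>2"
  using norm_fourier_le[of f "- \<zeta>"]
  by (simp add: inv_fourier_eq norm_mult norm_divide norm_power divide_right_mono)

lemma integrable_mult_inv_fourier:
  assumes "integrable lborel g" "schwartz f"
  shows "integrable lborel (\<lambda>\<zeta>. g \<zeta> * inv_fourier f \<zeta>)"
  using integrable_bounded_mult[OF assms(1) _ norm_inv_fourier_le, of f] schwartz_measurable[OF assms(2)]
  by (simp add: mult.commute)

text \<open>A supremum over an unbounded set would say nothing. Here only finitely many words
  contribute, each with its own bound, and the empty word gives \<open>f\<close> itself.\<close>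

lemma le_schwartz_seminorm:
  assumes f: "schwartz f"
  shows "(1 + norm z) ^ k * norm (f z) \<le> schwartz_seminorm k f"
proof -
  let ?A = "{es. set es \<subseteq> (Basis :: plane set) \<and> length es \<le> k}"
  have fin: "finite ?A" by (rule finite_lists_length_le) simp
  have "\<exists>B. \<forall>z. (1 + norm z) ^ k * norm (iter_deriv es f z) \<le> B" if "es \<in> ?A" for es
    using f that unfolding schwartz_def by blast
  from bchoice[OF ballI[OF this]] obtain B
    where "\<forall>es\<in>?A. \<forall>z. (1 + norm z) ^ k * norm (iter_deriv es f z) \<le> B es" ..
  then have B: "(1 + norm z) ^ k * norm (iter_deriv es f z) \<le> B es" if "es \<in> ?A" for es z
    using that by blast
  have bdd: "bdd_above (range (\<lambda>z. (1 + norm z) ^ k * (\<Sum>es\<in>?A. norm (iter_deriv es f z))))"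
    by (rule bdd_aboveI2[where M="\<Sum>es\<in>?A. B es"]) (unfold sum_distrib_left, intro sum_mono B)
  have "norm (f z) \<le> (\<Sum>es\<in>?A. norm (iter_deriv es f z))"
    using member_le_sum[of "[]" ?A "\<lambda>es. norm (iter_deriv es f z)"] fin by simp
  then have "(1 + norm z) ^ k * norm (f z) \<le> (1 + norm z) ^ k * (\<Sum>es\<in>?A. norm (iter_deriv es f z))"
    by (intro mult_left_mono) auto
  also have "\<dots> \<le> schwartz_seminorm k f"
    unfolding schwartz_seminorm_def by (rule cSUP_upper[OF UNIV_I bdd])
  finally show ?thesis .
qed

lemma inv_fourier_add:
  assumes f: "schwartz f" and h: "schwartz h"
  shows "inv_fourier (\<lambda>z. f z + h z) \<zeta> = inv_fourier f \<zeta> + inv_fourier h \<zeta>"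
proof -
  have "integrable lborel (\<lambda>z. cis (\<zeta> \<bullet> z) * f z)" "integrable lborel (\<lambda>z. cis (\<zeta> \<bullet> z) * h z)"
    by (intro integrable_cis_mult schwartz_integrable f h; simp)+
  then show ?thesis by (simp add: inv_fourier_def distrib_left)
qed

lemma inv_fourier_scale: "inv_fourier (\<lambda>z. c * f z) \<zeta> = c * inv_fourier f \<zeta>"
proof -
  have "(LINT z|lborel. cis (\<zeta> \<bullet> z) * (c * f z)) = c * (LINT z|lborel. cis (\<zeta> \<bullet> z) * f z)"
    unfolding integral_mult_right_zero[symmetric]
    by (intro Bochner_Integration.integral_cong) simp_all
  then show ?thesis by (simp add: inv_fourier_def)
qed

lemma inv_fourier_pd:
  assumes "schwartz f" "e \<in> Basis"
  shows "inv_fourier (pd e f) \<zeta> = - \<i> * of_real (\<zeta> \<bullet> e) * inv_fourier f \<zeta>"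
  by (simp add: inv_fourier_eq fourier_pd[OF assms])

text \<open>For continuity, \<open>inv_fourier f\<close> is bounded by the L^1 norm of
  \<open>f\<close>, which \<open>weight\<close> controls by the seminorm of order 4.\<close>

lemma tempered_inv_fourier_distr:
  assumes g: "integrable lborel g"
  shows "tempered (inv_fourier_distr g)"
  unfolding tempered_def
proof (intro conjI allI impI)
  fix f h assume f: "schwartz f" and h: "schwartz h"
  then show "inv_fourier_distr g (\<lambda>z. f z + h z) = inv_fourier_distr g f + inv_fourier_distr g h"
    using integrable_mult_inv_fourier[OF g f] integrable_mult_inv_fourier[OF g h]
    by (simp add: inv_fourier_distr_def schwartz_add inv_fourier_add distrib_left)
next
  fix c f assume f: "schwartz f"
  have "(LINT \<zeta>|lborel. g \<zeta> * (c * inv_fourier f \<zeta>)) = c * (LINT \<zeta>|lborel. g \<zeta> * inv_fourier f \<zeta>)"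
    unfolding integral_mult_right_zero[symmetric]
    by (intro Bochner_Integration.integral_cong) simp_all
  with f show "inv_fourier_distr g (\<lambda>z. c * f z) = c * inv_fourier_distr g f"
    by (simp add: inv_fourier_distr_def schwartz_scale inv_fourier_scale)
next
  let ?W = "LINT z|lborel. weight z"
  let ?G = "LINT \<zeta>|lborel. norm (g \<zeta>)"
  have "norm (inv_fourier_distr g f) \<le> (?G * ?W / (2 * pi)\<^sup>2) * schwartz_seminorm 4 f"
    if f: "schwartz f" for f
  proof -
    have "(LINT z|lborel. norm (f z)) \<le> (LINT z|lborel. schwartz_seminorm 4 f * weight z)"
      using schwartz_integrable[OF f] integrable_weight
      by (intro integral_mono norm_le_weight le_schwartz_seminorm f) auto
    then have W: "(LINT z|lborel. norm (f z)) \<le> schwartz_seminorm 4 f * ?W" by simp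
    have "norm (inv_fourier_distr g f) \<le> (LINT \<zeta>|lborel. norm (g \<zeta>) * ((schwartz_seminorm 4 f * ?W) / (2 * pi)\<^sup>2))"
      unfolding inv_fourier_distr_def if_P[OF f]
    proof (rule Bochner_Integration.integral_norm_bound_integral[OF integrable_mult_inv_fourier[OF g f]])
      fix \<zeta>
      show "norm (g \<zeta> * inv_fourier f \<zeta>) \<le> norm (g \<zeta>) * ((schwartz_seminorm 4 f * ?W) / (2 * pi)\<^sup>2)"
        unfolding norm_mult
        by (intro mult_left_mono order_trans[OF norm_inv_fourier_le] divide_right_mono W) auto
    qed (use g in auto)
    also have "\<dots> = (?G * ?W / (2 * pi)\<^sup>2) * schwartz_seminorm 4 f" by simp
    finally show ?thesis .
  qed
  then show "\<exists>C k. \<forall>f. schwartz f \<longrightarrow> norm (inv_fourier_distr g f) \<le> C * schwartz_seminorm k f"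
    by blast
qed (simp add: inv_fourier_distr_def)

lemma has_fourier_fun_inv_fourier_distr:
  assumes g: "integrable lborel g"
  shows "has_fourier_fun (inv_fourier_distr g) g"
  unfolding has_fourier_fun_def
proof (intro conjI allI impI)
  fix f assume f: "schwartz f"
  obtain B where B: "\<And>z. norm (f z) \<le> B" using schwartz_bounded[OF f] by blast
  show "integrable lborel (\<lambda>\<zeta>. g \<zeta> * f \<zeta>)"
    using integrable_bounded_mult[OF g, of f B] B schwartz_measurable[OF f] by (simp add: mult.commute)
  show "inv_fourier_distr g (fourier f) = (LINT \<zeta>|lborel. g \<zeta> * f \<zeta>)"
    by (simp add: inv_fourier_distr_def schwartz_fourier f fourier_inversion)
qed (use g in auto)

lemma inv_fourier_distr_cong_AE:
  assumes "AE \<zeta> in lborel. g \<zeta> = g' \<zeta>" and [measurable]: "g \<in> borel_measurable borel" "g' \<in> borel_measurable borel"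
  shows "inv_fourier_distr g = inv_fourier_distr g'"
proof
  fix f show "inv_fourier_distr g f = inv_fourier_distr g' f"
  proof (cases "schwartz f")
    case True
    then have [measurable]: "f \<in> borel_measurable borel" by (rule schwartz_measurable)
    have "(LINT \<zeta>|lborel. g \<zeta> * inv_fourier f \<zeta>) = (LINT \<zeta>|lborel. g' \<zeta> * inv_fourier f \<zeta>)"
      by (rule integral_cong_AE) (use assms(1) in \<open>auto\<close>)
    then show ?thesis by (simp add: inv_fourier_distr_def)
  qed (simp add: inv_fourier_distr_def)
qed

text \<open>The minus sign in \<open>distr_dx\<close> cancels the one in
  \<open>inv_fourier_pd\<close>.\<close>

lemma distr_dx_inv_fourier_distr:
  "distr_dx (inv_fourier_distr g) = inv_fourier_distr (\<lambda>\<zeta>. \<i> * of_real (\<zeta> \<bullet> (1, 0)) * g \<zeta>)"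
proof
  fix f show "distr_dx (inv_fourier_distr g) f = inv_fourier_distr (\<lambda>\<zeta>. \<i> * of_real (\<zeta> \<bullet> (1, 0)) * g \<zeta>) f"
  proof (cases "schwartz f")
    case True
    have "distr_dx (inv_fourier_distr g) f
        = - (LINT \<zeta>|lborel. g \<zeta> * (- \<i> * of_real (\<zeta> \<bullet> (1, 0)) * inv_fourier f \<zeta>))"
      using True schwartz_pd[OF True Basis_plane(1)] unfolding distr_dx_def inv_fourier_distr_def iter_deriv_single
      by (simp add: inv_fourier_pd[OF True Basis_plane(1)])
    also have "\<dots> = (LINT \<zeta>|lborel. - (g \<zeta> * (- \<i> * of_real (\<zeta> \<bullet> (1, 0)) * inv_fourier f \<zeta>)))"
      by simp
    also have "\<dots> = (LINT \<zeta>|lborel. (\<i> * of_real (\<zeta> \<bullet> (1, 0)) * g \<zeta>) * inv_fourier f \<zeta>)"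
      by (intro Bochner_Integration.integral_cong) simp_all
    finally show ?thesis using True by (simp add: inv_fourier_distr_def)
  qed (simp add: distr_dx_def inv_fourier_distr_def)
qed

section \<open>Products\<close>

definition conv :: "(plane \<Rightarrow> complex) \<Rightarrow> (plane \<Rightarrow> complex) \<Rightarrow> plane \<Rightarrow> complex" where
  "conv f g \<zeta> = (LINT \<omega>|lborel. f \<omega> * g (\<zeta> - \<omega>))"

text \<open>Fubini for \<open>f \<omega> * g (\<zeta> - \<omega>)\<close>; splitting the phase at
  \<open>\<omega>\<close> and translating separates the two integrals.\<close>

lemma
  assumes f: "integrable lborel f" and g: "integrable lborel g"
  shows integrable_conv: "integrable lborel (conv f g)"
    and integral_cis_conv: "(LINT \<zeta>|lborel. cis (z \<bullet> \<zeta>) * conv f g \<zeta>)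
      = (LINT \<zeta>|lborel. cis (z \<bullet> \<zeta>) * f \<zeta>) * (LINT \<zeta>|lborel. cis (z \<bullet> \<zeta>) * g \<zeta>)"
proof -
  have [measurable]: "f \<in> borel_measurable borel" "g \<in> borel_measurable borel"
    using f g by auto
  have shift: "(LINT \<zeta>|lborel. G (\<zeta> - \<omega>)) = (LINT \<zeta>|lborel. G \<zeta>)"
    if [measurable]: "G \<in> borel_measurable borel" for G :: "plane \<Rightarrow> 'b::{banach, second_countable_topology}" and \<omega>
    using lborel_integral_affine[of G 1 "- \<omega>"] by simp
  have shiftI: "integrable lborel (\<lambda>\<zeta>. g (\<zeta> - \<omega>))" for \<omega>
    using lborel_integrable_affine[OF g, of 1 "- \<omega>"] by simp
  have I: "integrable (lborel \<Otimes>\<^sub>M lborel) (\<lambda>(\<omega>, \<zeta>). f \<omega> * g (\<zeta> - \<omega>))"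
  proof (rule lborel_pair.Fubini_integrable)
    show "integrable lborel (\<lambda>\<omega>. LINT \<zeta>|lborel. norm (case (\<omega>, \<zeta>) of (\<omega>, \<zeta>) \<Rightarrow> f \<omega> * g (\<zeta> - \<omega>)))"
      using f by (simp add: norm_mult shift[of "\<lambda>\<zeta>. norm (g \<zeta>)"])
    show "AE \<omega> in lborel. integrable lborel (\<lambda>\<zeta>. case (\<omega>, \<zeta>) of (\<omega>, \<zeta>) \<Rightarrow> f \<omega> * g (\<zeta> - \<omega>))"
      using shiftI by simp
  qed measurable
  show "integrable lborel (conv f g)"
    unfolding conv_def[abs_def] using lborel_pair.integrable_snd[OF I] .
  have I2: "integrable (lborel \<Otimes>\<^sub>M lborel) (\<lambda>(\<omega>, \<zeta>). cis (z \<bullet> \<zeta>) * (f \<omega> * g (\<zeta> - \<omega>)))"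
    using integrable_cis_mult[OF I, of "\<lambda>(\<omega>, \<zeta>). z \<bullet> \<zeta>"] by (simp add: case_prod_beta')
  have "(LINT \<zeta>|lborel. cis (z \<bullet> \<zeta>) * conv f g \<zeta>)
      = (LINT \<zeta>|lborel. (LINT \<omega>|lborel. cis (z \<bullet> \<zeta>) * (f \<omega> * g (\<zeta> - \<omega>))))"
    by (simp add: conv_def)
  also have "\<dots> = (LINT \<omega>|lborel. (LINT \<zeta>|lborel. cis (z \<bullet> \<zeta>) * (f \<omega> * g (\<zeta> - \<omega>))))"
    by (rule lborel_pair.Fubini_integral[OF I2])
  also have "\<dots> = (LINT \<omega>|lborel. (cis (z \<bullet> \<omega>) * f \<omega>) * (LINT \<zeta>|lborel. cis (z \<bullet> \<zeta>) * g \<zeta>))"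
  proof (rule Bochner_Integration.integral_cong[OF refl])
    fix \<omega>
    have "(LINT \<zeta>|lborel. cis (z \<bullet> \<zeta>) * (f \<omega> * g (\<zeta> - \<omega>)))
        = (LINT \<zeta>|lborel. (cis (z \<bullet> \<omega>) * f \<omega>) * (cis (z \<bullet> (\<zeta> - \<omega>)) * g (\<zeta> - \<omega>)))"
    proof (rule Bochner_Integration.integral_cong[OF refl])
      fix \<zeta>
      have "cis (z \<bullet> \<zeta>) = cis (z \<bullet> \<omega>) * cis (z \<bullet> (\<zeta> - \<omega>))"
        by (simp add: cis_mult inner_diff_right)
      then show "cis (z \<bullet> \<zeta>) * (f \<omega> * g (\<zeta> - \<omega>)) = (cis (z \<bullet> \<omega>) * f \<omega>) * (cis (z \<bullet> (\<zeta> - \<omega>)) * g (\<zeta> - \<omega>))"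
        by simp
    qed
    also have "\<dots> = (cis (z \<bullet> \<omega>) * f \<omega>) * (LINT \<zeta>|lborel. cis (z \<bullet> \<zeta>) * g \<zeta>)"
      using shift[of "\<lambda>\<zeta>. cis (z \<bullet> \<zeta>) * g \<zeta>" \<omega>] by simp
    finally show "(LINT \<zeta>|lborel. cis (z \<bullet> \<zeta>) * (f \<omega> * g (\<zeta> - \<omega>)))
        = (cis (z \<bullet> \<omega>) * f \<omega>) * (LINT \<zeta>|lborel. cis (z \<bullet> \<zeta>) * g \<zeta>)" .
  qed
  also have "\<dots> = (LINT \<zeta>|lborel. cis (z \<bullet> \<zeta>) * f \<zeta>) * (LINT \<zeta>|lborel. cis (z \<bullet> \<zeta>) * g \<zeta>)"
    by simp
  finally show "(LINT \<zeta>|lborel. cis (z \<bullet> \<zeta>) * conv f g \<zeta>)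
      = (LINT \<zeta>|lborel. cis (z \<bullet> \<zeta>) * f \<zeta>) * (LINT \<zeta>|lborel. cis (z \<bullet> \<zeta>) * g \<zeta>)" .
qed

text \<open>The factor \<open>1 / pi\<close> gives the mollifier mass 1. Seen from \<open>z\<close>,
  the rescaled mollifier is a Gaussian test function whose inverse transform is again explicit, so
  mollification is damping in frequency.\<close>

lemma mollify_gauss_inv_fourier_distr:
  assumes \<epsilon>: "0 < \<epsilon>"
  shows "mollify (\<lambda>z. of_real (1 / pi) * gauss 1 0 z) \<epsilon> (inv_fourier_distr g) z
    = of_real (1 / (2 * pi)\<^sup>2) * (LINT \<zeta>|lborel. cis (z \<bullet> \<zeta>) * (of_real (exp (- \<epsilon>\<^sup>2 * (norm \<zeta>)\<^sup>2 / 4)) * g \<zeta>))"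
proof -
  define m where "m w = complex_of_real (1 / \<epsilon>\<^sup>2) * (of_real (1 / pi) * gauss 1 0 ((1 / \<epsilon>) *\<^sub>R (z - w)))" for w
  have m1: "m w = of_real (1 / (pi * \<epsilon>\<^sup>2)) * of_real (exp (- (norm (z - w))\<^sup>2 / \<epsilon>\<^sup>2))" for w
    using \<epsilon> by (simp add: m_def gauss_def power_divide)
  have "exp (- (norm (z - w))\<^sup>2 / \<epsilon>\<^sup>2) = exp (- (norm z)\<^sup>2 / \<epsilon>\<^sup>2) * exp (((2 / \<epsilon>\<^sup>2) *\<^sub>R z) \<bullet> w - 1 / \<epsilon>\<^sup>2 * (norm w)\<^sup>2)" for w
    unfolding exp_add[symmetric] power2_norm_eq_inner
    by (simp add: inner_diff_left inner_diff_right inner_commute add_divide_distrib diff_divide_distrib)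
  then have "m w = of_real (1 / (pi * \<epsilon>\<^sup>2) * exp (- (norm z)\<^sup>2 / \<epsilon>\<^sup>2)) * gauss (1 / \<epsilon>\<^sup>2) ((2 / \<epsilon>\<^sup>2) *\<^sub>R z) w" for w
    unfolding m1 gauss_def by simp
  then have "m = (\<lambda>w. of_real (1 / (pi * \<epsilon>\<^sup>2) * exp (- (norm z)\<^sup>2 / \<epsilon>\<^sup>2)) * gauss (1 / \<epsilon>\<^sup>2) ((2 / \<epsilon>\<^sup>2) *\<^sub>R z) w)"
    by blast
  then have schw: "schwartz m" using \<epsilon> by (simp only:) (intro schwartz_scale schwartz_gauss, simp)
  have F: "inv_fourier m \<zeta> = of_real (1 / (2 * pi)\<^sup>2) * (cis (z \<bullet> \<zeta>) * of_real (exp (- \<epsilon>\<^sup>2 * (norm \<zeta>)\<^sup>2 / 4)))" for \<zeta>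
  proof -
    have "(LINT w|lborel. cis (\<zeta> \<bullet> w) * m w)
        = of_real (1 / (pi * \<epsilon>\<^sup>2)) * (LINT w|lborel. cis (\<zeta> \<bullet> w) * of_real (exp (- (norm (z - w))\<^sup>2 / \<epsilon>\<^sup>2)))"
      unfolding m1 integral_mult_right_zero[symmetric]
      by (intro Bochner_Integration.integral_cong) (simp_all add: mult_ac)
    also have "\<dots> = of_real (1 / (pi * \<epsilon>\<^sup>2)) * (of_real (\<epsilon>\<^sup>2) * (LINT w|lborel. cis (\<zeta> \<bullet> (z + \<epsilon> *\<^sub>R w)) * gauss 1 0 w))"
      using \<epsilon> by (subst gauss_change_of_variables) auto
    also have "(LINT w|lborel. cis (\<zeta> \<bullet> (z + \<epsilon> *\<^sub>R w)) * gauss 1 0 w)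
        = (LINT w|lborel. cis (z \<bullet> \<zeta>) * (cis (w \<bullet> (\<epsilon> *\<^sub>R \<zeta>)) * gauss 1 0 w))"
      by (intro Bochner_Integration.integral_cong) (simp_all add: inner_add_right inner_commute flip: cis_mult)
    also have "\<dots> = cis (z \<bullet> \<zeta>) * of_real (pi * exp (- \<epsilon>\<^sup>2 * (norm \<zeta>)\<^sup>2 / 4))"
      unfolding integral_mult_right_zero by (subst integral_gauss) (simp_all add: power_mult_distrib)
    finally show ?thesis using \<epsilon> by (simp add: inv_fourier_def)
  qed
  have "mollify (\<lambda>z. of_real (1 / pi) * gauss 1 0 z) \<epsilon> (inv_fourier_distr g) z = inv_fourier_distr g m"
    unfolding mollify_def m_def[abs_def] ..
  also have "\<dots> = (LINT \<zeta>|lborel. of_real (1 / (2 * pi)\<^sup>2) * (cis (z \<bullet> \<zeta>) * (of_real (exp (- \<epsilon>\<^sup>2 * (norm \<zeta>)\<^sup>2 / 4)) * g \<zeta>)))"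
    unfolding inv_fourier_distr_def if_P[OF schw] F
    by (intro Bochner_Integration.integral_cong) (simp_all add: mult_ac)
  finally show ?thesis by simp
qed

text \<open>\<open>has_product\<close> allows every mollifier, so the Gaussian may be chosen. The
  regularizations then converge boundedly to the inverse transforms of \<open>g1\<close> and
  \<open>g2\<close>, and the limit \<open>w\<close> is forced to be their pointwise product; the
  convolution theorem and inversion move this to the frequency side. The value of the product is
  determined here, its existence is assumed.\<close>

lemma has_product_fourier:
  assumes g1: "integrable lborel g1" and g2: "integrable lborel g2"
    and w: "has_product (inv_fourier_distr g1) (inv_fourier_distr g2) w" and h: "schwartz h"
  shows "w (fourier h) = (LINT \<zeta>|lborel. of_real (1 / (2 * pi)\<^sup>2) * conv g1 g2 \<zeta> * h \<zeta>)"
proof -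
  let ?c = "complex_of_real (1 / (2 * pi)\<^sup>2)"
  let ?\<rho> = "\<lambda>z. of_real (1 / pi) * gauss 1 0 z"
  define f where "f = fourier h"
  have f: "schwartz f" unfolding f_def by (intro schwartz_fourier h)
  note [measurable] = schwartz_measurable[OF f]
  define X where "X n = inverse (real (Suc n))" for n
  have X: "X \<longlonglongrightarrow> 0" "X n > 0" for n
    unfolding X_def[abs_def] by (rule LIMSEQ_inverse_real_of_nat) simp
  have "filterlim X (at_right 0) sequentially"
    by (rule tendsto_imp_filterlim_at_right[OF X(1)]) (use X(2) in auto)
  moreover have "(LINT z|lborel. ?\<rho> z) = 1"
    using integral_gauss[of 1 0] by simp
  then have "((\<lambda>\<epsilon>. LINT z|lborel. mollify ?\<rho> \<epsilon> (inv_fourier_distr g1) z * mollify ?\<rho> \<epsilon> (inv_fourier_distr g2) z * f z)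
      \<longlongrightarrow> w f) (at_right 0)"
    using w f schwartz_scale[OF schwartz_gauss[of 1 0], of "of_real (1 / pi)"]
    unfolding has_product_def by auto
  ultimately have lim1: "(\<lambda>n. LINT z|lborel. mollify ?\<rho> (X n) (inv_fourier_distr g1) z *
      mollify ?\<rho> (X n) (inv_fourier_distr g2) z * f z) \<longlonglongrightarrow> w f"
    by (rule filterlim_compose[rotated])
  \<comment> \<open>\<open>?A g n\<close> is the mollification at scale \<open>X n\<close>,
    \<open>?a g\<close> its pointwise limit, and \<open>?N g\<close> a bound uniform in
    \<open>n\<close> and \<open>z\<close>.\<close>
  let ?A = "\<lambda>g n z. ?c * (LINT \<zeta>|lborel. cis (z \<bullet> \<zeta>) * (of_real (exp (- (X n)\<^sup>2 * (norm \<zeta>)\<^sup>2 / 4)) * g \<zeta>))"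
  let ?a = "\<lambda>g z. ?c * (LINT \<zeta>|lborel. cis (z \<bullet> \<zeta>) * g \<zeta>)"
  let ?N = "\<lambda>g. norm ?c * (LINT \<zeta>|lborel. norm (g \<zeta>))"
  have A: "(\<lambda>n. ?A g n z) \<longlonglongrightarrow> ?a g z" "norm (?A g n z) \<le> ?N g"
    "?A g n \<in> borel_measurable borel" "?a g \<in> borel_measurable borel"
    if g: "integrable lborel g" for g z n
  proof -
    have [measurable]: "g \<in> borel_measurable borel" using g by auto
    have le: "norm (cis (z \<bullet> \<zeta>) * (of_real (exp (- (X n)\<^sup>2 * (norm \<zeta>)\<^sup>2 / 4)) * g \<zeta>)) \<le> norm (g \<zeta>)" for n \<zeta>
      by (simp add: norm_mult mult_left_le_one_le)
    have 1: "(\<lambda>n. LINT \<zeta>|lborel. cis (z \<bullet> \<zeta>) * (of_real (exp (- (X n)\<^sup>2 * (norm \<zeta>)\<^sup>2 / 4)) * g \<zeta>))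
        \<longlonglongrightarrow> (LINT \<zeta>|lborel. cis (z \<bullet> \<zeta>) * g \<zeta>)"
    proof (rule integral_dominated_convergence[where w="\<lambda>\<zeta>. norm (g \<zeta>)"])
      have "(\<lambda>n. complex_of_real (exp (- (X n)\<^sup>2 * (norm \<zeta>)\<^sup>2 / 4))) \<longlonglongrightarrow> of_real (exp (- (0\<^sup>2) * (norm \<zeta>)\<^sup>2 / 4))" for \<zeta>
        by (intro tendsto_intros X) simp
      then have "(\<lambda>n. cis (z \<bullet> \<zeta>) * (of_real (exp (- (X n)\<^sup>2 * (norm \<zeta>)\<^sup>2 / 4)) * g \<zeta>))
          \<longlonglongrightarrow> cis (z \<bullet> \<zeta>) * (of_real (exp (- (0\<^sup>2) * (norm \<zeta>)\<^sup>2 / 4)) * g \<zeta>)" for \<zeta>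
        by (intro tendsto_mult tendsto_const)
      then show "AE \<zeta> in lborel. (\<lambda>n. cis (z \<bullet> \<zeta>) * (of_real (exp (- (X n)\<^sup>2 * (norm \<zeta>)\<^sup>2 / 4)) * g \<zeta>))
          \<longlonglongrightarrow> cis (z \<bullet> \<zeta>) * g \<zeta>" by simp
      show "AE \<zeta> in lborel. norm (cis (z \<bullet> \<zeta>) * (of_real (exp (- (X n)\<^sup>2 * (norm \<zeta>)\<^sup>2 / 4)) * g \<zeta>)) \<le> norm (g \<zeta>)" for n
        by (intro always_eventually allI le)
    qed (use g in auto)
    show "(\<lambda>n. ?A g n z) \<longlonglongrightarrow> ?a g z"
      by (intro tendsto_mult tendsto_const 1)
    have "norm (LINT \<zeta>|lborel. cis (z \<bullet> \<zeta>) * (of_real (exp (- (X n)\<^sup>2 * (norm \<zeta>)\<^sup>2 / 4)) * g \<zeta>))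
        \<le> (LINT \<zeta>|lborel. norm (g \<zeta>))"
    proof (rule Bochner_Integration.integral_norm_bound_integral)
      show "integrable lborel (\<lambda>\<zeta>. cis (z \<bullet> \<zeta>) * (of_real (exp (- (X n)\<^sup>2 * (norm \<zeta>)\<^sup>2 / 4)) * g \<zeta>))"
        by (intro integrable_cis_mult integrable_bounded_mult[OF g, where B=1]) auto
    qed (use g le in auto)
    then show "norm (?A g n z) \<le> ?N g" unfolding norm_mult by (intro mult_left_mono) auto
    show "?A g n \<in> borel_measurable borel" "?a g \<in> borel_measurable borel" by measurable
  qed
  have "(\<lambda>n. LINT z|lborel. ?A g1 n z * ?A g2 n z * f z) \<longlonglongrightarrow> (LINT z|lborel. ?a g1 z * ?a g2 z * f z)"
  proof (rule integral_dominated_convergence[where w="\<lambda>z. ?N g1 * ?N g2 * norm (f z)"])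
    show "AE z in lborel. (\<lambda>n. ?A g1 n z * ?A g2 n z * f z) \<longlonglongrightarrow> ?a g1 z * ?a g2 z * f z"
      by (intro always_eventually allI tendsto_mult tendsto_const A(1)[OF g1, unfolded norm_mult] A(1)[OF g2])
    show "AE z in lborel. norm (?A g1 n z * ?A g2 n z * f z) \<le> ?N g1 * ?N g2 * norm (f z)" for n
      unfolding norm_mult[of _ "f _"] norm_mult[of "?A g1 n _" "?A g2 n _"]
      by (intro always_eventually allI mult_right_mono mult_mono A(2) g1 g2) auto
    show "(\<lambda>z. ?a g1 z * ?a g2 z * f z) \<in> borel_measurable lborel"
      "\<And>n. (\<lambda>z. ?A g1 n z * ?A g2 n z * f z) \<in> borel_measurable lborel"
      using A(3,4)[OF g1] A(3,4)[OF g2] by measurable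
  qed (use schwartz_integrable[OF f] in auto)
  then have "w f = (LINT z|lborel. ?a g1 z * ?a g2 z * f z)"
    by (rule LIMSEQ_unique[OF lim1[unfolded mollify_gauss_inv_fourier_distr[OF X(2)]]])
  \<comment> \<open>Each inverse transform contributes one factor \<open>?c\<close>. One of the two
    is absorbed when \<open>inv_fourier f\<close> is recognized as \<open>h\<close>; the other is
    the normalization of the convolution.\<close>
  also have "\<dots> = (LINT z|lborel. (LINT \<zeta>|lborel. ?c * ?c * (cis (z \<bullet> \<zeta>) * (f z * conv g1 g2 \<zeta>))))"
  proof (rule Bochner_Integration.integral_cong[OF refl])
    fix z
    have "(LINT \<zeta>|lborel. ?c * ?c * (cis (z \<bullet> \<zeta>) * (f z * conv g1 g2 \<zeta>)))
        = (LINT \<zeta>|lborel. (?c * ?c * f z) * (cis (z \<bullet> \<zeta>) * conv g1 g2 \<zeta>))"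
      by (intro Bochner_Integration.integral_cong) (simp_all add: mult_ac)
    also have "\<dots> = (?c * ?c * f z) * (LINT \<zeta>|lborel. cis (z \<bullet> \<zeta>) * conv g1 g2 \<zeta>)"
      by (rule integral_mult_right_zero)
    finally show "?a g1 z * ?a g2 z * f z = (LINT \<zeta>|lborel. ?c * ?c * (cis (z \<bullet> \<zeta>) * (f z * conv g1 g2 \<zeta>)))"
      unfolding integral_cis_conv[OF g1 g2] by (simp only: mult_ac)
  qed
  also have "\<dots> = (LINT \<zeta>|lborel. (LINT z|lborel. ?c * ?c * (cis (z \<bullet> \<zeta>) * (f z * conv g1 g2 \<zeta>))))"
  proof (rule lborel_pair.Fubini_integral[symmetric])
    have "integrable (lborel \<Otimes>\<^sub>M lborel) (\<lambda>(z, \<zeta>). cis (z \<bullet> \<zeta>) * (f z * conv g1 g2 \<zeta>))"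
      by (rule integrable_kernel[OF schwartz_integrable[OF f] integrable_conv[OF g1 g2], where B=1]) auto
    from integrable_mult_right[OF this, of "?c * ?c"]
    show "integrable (lborel \<Otimes>\<^sub>M lborel) (\<lambda>(z, \<zeta>). ?c * ?c * (cis (z \<bullet> \<zeta>) * (f z * conv g1 g2 \<zeta>)))"
      by (simp add: case_prod_beta')
  qed
  also have "\<dots> = (LINT \<zeta>|lborel. ?c * conv g1 g2 \<zeta> * h \<zeta>)"
  proof (rule Bochner_Integration.integral_cong[OF refl])
    fix \<zeta>
    have "(LINT z|lborel. ?c * ?c * (cis (z \<bullet> \<zeta>) * (f z * conv g1 g2 \<zeta>)))
        = (LINT z|lborel. (?c * ?c * conv g1 g2 \<zeta>) * (cis (\<zeta> \<bullet> z) * f z))"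
      by (intro Bochner_Integration.integral_cong) (simp_all add: mult_ac inner_commute)
    also have "\<dots> = (?c * ?c * conv g1 g2 \<zeta>) * (LINT z|lborel. cis (\<zeta> \<bullet> z) * f z)"
      by (rule integral_mult_right_zero)
    also have "\<dots> = ?c * conv g1 g2 \<zeta> * inv_fourier f \<zeta>"
      unfolding inv_fourier_def by (simp only: mult_ac)
    also have "inv_fourier f \<zeta> = h \<zeta>"
      unfolding f_def by (rule fourier_inversion[OF h])
    finally show "(LINT z|lborel. ?c * ?c * (cis (z \<bullet> \<zeta>) * (f z * conv g1 g2 \<zeta>))) = ?c * conv g1 g2 \<zeta> * h \<zeta>" .
  qed
  finally show ?thesis unfolding f_def .
qed

section \<open>The Duhamel term of a free evolution\<close>

lemma disp_symbol_measurable [measurable]: "disp_symbol \<alpha> \<in> borel_measurable borel"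
proof -
  have "disp_symbol \<alpha> = (\<lambda>z. \<bar>fst z\<bar> powr \<alpha> * fst z + sgn (fst z) * (snd z)\<^sup>2)"
    by (auto simp: disp_symbol_def)
  then show ?thesis
    unfolding borel_prod[symmetric] by (simp only:) measurable
qed

lemma U_eq:
  assumes "has_fourier_fun u g"
  shows "U \<alpha> t u = inv_fourier_distr (\<lambda>\<zeta>. cis (- t * disp_symbol \<alpha> \<zeta>) * g \<zeta>)"
proof -
  have [measurable]: "g \<in> borel_measurable borel" "fourier_fun u \<in> borel_measurable borel"
    using assms has_fourier_fun_fourier_fun[OF assms] by (auto intro: has_fourier_fun_measurable)
  show ?thesis
    unfolding U_def using AE_fourier_fun[OF assms] by (intro inv_fourier_distr_cong_AE) auto
qed

section \<open>The Fourier transform of the Duhamel term\<close>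

lemma integrable_schwartz_mult:
  assumes "integrable lborel g" "schwartz h"
  shows "integrable lborel (\<lambda>\<zeta>. g \<zeta> * h \<zeta>)"
  using has_fourier_fun_inv_fourier_distr[OF assms(1)] assms(2) by (simp add: has_fourier_fun_def)

text \<open>The Fourier transform of u u_x for the free evolution u(t) whose initial datum has
  transform \<open>g\<close>: the second factor of the convolution carries the symbol of the
  x-derivative.\<close>

definition interaction :: "real \<Rightarrow> (plane \<Rightarrow> complex) \<Rightarrow> real \<Rightarrow> plane \<Rightarrow> complex" where
  "interaction \<alpha> g t = (\<lambda>\<zeta>. of_real (1 / (2 * pi)\<^sup>2) * conv
     (\<lambda>\<omega>. cis (- t * disp_symbol \<alpha> \<omega>) * g \<omega>)
     (\<lambda>\<omega>. \<i> * of_real (\<omega> \<bullet> (1, 0)) * (cis (- t * disp_symbol \<alpha> \<omega>) * g \<omega>)) \<zeta>)"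

text \<open>\<open>has_product_fourier\<close> identifies the integrand for almost every time, and
  therefore its image under the group. A majorant independent of time then allows the time integral,
  defined only against test functions, to be exchanged with the frequency integral.\<close>

lemma duhamel_fourier:
  assumes g: "integrable lborel g" and xg: "integrable lborel (\<lambda>\<zeta>. of_real (\<zeta> \<bullet> (1, 0)) * g \<zeta>)"
    and T: "0 \<le> T"
    and duh: "is_duhamel \<alpha> T (on_interval T (\<lambda>t. U \<alpha> t (inv_fourier_distr g))) v"
  shows "has_fourier_fun (v T)
    (\<lambda>\<zeta>. LINT t:{0..T}|lborel. cis (- (T - t) * disp_symbol \<alpha> \<zeta>) * interaction \<alpha> g t \<zeta>)"
proof -
  let ?p = "disp_symbol \<alpha>"
  have [measurable]: "g \<in> borel_measurable borel" using g by auto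
  let ?g1 = "\<lambda>t \<omega>. cis (- t * ?p \<omega>) * g \<omega>"
  let ?g2 = "\<lambda>t \<omega>. \<i> * of_real (\<omega> \<bullet> (1, 0)) * (cis (- t * ?p \<omega>) * g \<omega>)"
  have g1: "integrable lborel (?g1 t)" for t
    by (intro integrable_cis_mult g) measurable
  have g2: "integrable lborel (?g2 t)" for t
  proof -
    have "integrable lborel (\<lambda>\<omega>. \<i> * (cis (- t * ?p \<omega>) * (of_real (\<omega> \<bullet> (1, 0)) * g \<omega>)))"
      by (intro integrable_mult_right integrable_cis_mult xg) measurable
    then show ?thesis by (simp add: mult_ac)
  qed
  let ?G = "interaction \<alpha> g"
  have G: "integrable lborel (?G t)" for t
    unfolding interaction_def by (intro integrable_mult_right integrable_conv g1 g2)
  have Gm [measurable]: "case_prod ?G \<in> borel_measurable (borel \<Otimes>\<^sub>M borel)"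
    unfolding interaction_def conv_def by measurable
  obtain w where "AE t in lborel. t \<in> {0..T} \<longrightarrow>
        has_product (on_interval T (\<lambda>t. U \<alpha> t (inv_fourier_distr g)) t)
          (distr_dx (on_interval T (\<lambda>t. U \<alpha> t (inv_fourier_distr g)) t)) (w t) \<and> (\<exists>g. has_fourier_fun (w t) g)"
    and v: "\<forall>t\<in>{0..T}. \<forall>f. schwartz f \<longrightarrow> set_integrable lborel {0..t} (\<lambda>t'. U \<alpha> (t - t') (w t') f) \<and>
      v t f = (LINT t':{0..t}|lborel. U \<alpha> (t - t') (w t') f)"
    using duh unfolding is_duhamel_def by blast
  then have w: "AE t in lborel. t \<in> {0..T} \<longrightarrow>
        has_product (on_interval T (\<lambda>t. U \<alpha> t (inv_fourier_distr g)) t)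
          (distr_dx (on_interval T (\<lambda>t. U \<alpha> t (inv_fourier_distr g)) t)) (w t)"
    by (elim AE_mp) (intro always_eventually, blast)
  have w2: "AE t in lborel. t \<in> {0..T} \<longrightarrow>
      U \<alpha> (T - t) (w t) = inv_fourier_distr (\<lambda>\<zeta>. cis (- (T - t) * ?p \<zeta>) * ?G t \<zeta>)"
    using w
  proof eventually_elim
    case (elim t)
    show ?case
    proof
      assume t: "t \<in> {0..T}"
      have "on_interval T (\<lambda>t. U \<alpha> t (inv_fourier_distr g)) t = inv_fourier_distr (?g1 t)"
        using t U_eq[OF has_fourier_fun_inv_fourier_distr[OF g]] by (simp add: on_interval_def)
      with elim t have hp: "has_product (inv_fourier_distr (?g1 t)) (inv_fourier_distr (?g2 t)) (w t)"
        by (simp only: distr_dx_inv_fourier_distr)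
      have "has_fourier_fun (w t) (?G t)"
        unfolding has_fourier_fun_def
        using has_product_fourier[OF g1 g2 hp] integrable_schwartz_mult[OF G] G[of t]
        by (auto simp: interaction_def)
      then show "U \<alpha> (T - t) (w t) = inv_fourier_distr (\<lambda>\<zeta>. cis (- (T - t) * ?p \<zeta>) * ?G t \<zeta>)"
        by (rule U_eq)
    qed
  qed
  \<comment> \<open>The phases have modulus 1, so convolving the moduli of the two factors bounds
    the interaction at all times.\<close>
  define M where "M = conv (\<lambda>\<zeta>. of_real (norm (g \<zeta>))) (\<lambda>\<zeta>. of_real (norm (of_real (\<zeta> \<bullet> (1, 0)) * g \<zeta>)))"
  have M: "integrable lborel M"
    unfolding M_def by (intro integrable_conv integrable_of_real integrable_norm g xg)
  have GM: "norm (?G t \<zeta>) \<le> norm (M \<zeta>)" for t \<zeta>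
  proof -
    have "norm (conv (?g1 t) (?g2 t) \<zeta>) \<le> (LINT \<omega>|lborel. norm (?g1 t \<omega> * ?g2 t (\<zeta> - \<omega>)))"
      unfolding conv_def by (rule integral_norm_bound)
    also have "\<dots> = (LINT \<omega>|lborel. norm (g \<omega>) * norm (of_real ((\<zeta> - \<omega>) \<bullet> (1, 0)) * g (\<zeta> - \<omega>)))"
      by (simp add: norm_mult)
    also have "\<dots> = norm (M \<zeta>)"
    proof -
      have "M \<zeta> = of_real (LINT \<omega>|lborel. norm (g \<omega>) * norm (of_real ((\<zeta> - \<omega>) \<bullet> (1, 0)) * g (\<zeta> - \<omega>)))"
        unfolding M_def conv_def by (simp flip: of_real_mult integral_complex_of_real)
      moreover have "0 \<le> (LINT \<omega>|lborel. norm (g \<omega>) * norm (of_real ((\<zeta> - \<omega>) \<bullet> (1, 0)) * g (\<zeta> - \<omega>)))"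
        by simp
      ultimately show ?thesis by simp
    qed
    finally have "norm (conv (?g1 t) (?g2 t) \<zeta>) \<le> norm (M \<zeta>)" .
    moreover have "norm (complex_of_real (1 / (2 * pi)\<^sup>2)) \<le> 1"
    proof -
      have "1 \<le> 2 * pi" using pi_ge_two by simp
      then have "1 \<le> (2 * pi)\<^sup>2" by (rule one_le_power)
      then show ?thesis by (simp only: norm_of_real) (simp add: divide_le_eq)
    qed
    ultimately have "norm (complex_of_real (1 / (2 * pi)\<^sup>2)) * norm (conv (?g1 t) (?g2 t) \<zeta>) \<le> 1 * norm (M \<zeta>)"
      by (intro mult_mono) auto
    then show ?thesis unfolding interaction_def norm_mult by simp
  qed
  define k where "k t \<zeta> = indicator {0..T} t *\<^sub>R (cis (- (T - t) * ?p \<zeta>) * ?G t \<zeta>)" for t \<zeta>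
  have km [measurable]: "case_prod k \<in> borel_measurable (borel \<Otimes>\<^sub>M borel)"
    unfolding k_def by measurable
  have kM: "norm (k t \<zeta>) \<le> indicator {0..T} t * norm (M \<zeta>)" for t \<zeta>
    using GM[of t \<zeta>] by (simp add: k_def norm_mult mult_left_mono indicator_def)
  have kI: "integrable (lborel \<Otimes>\<^sub>M lborel) (case_prod k)"
  proof (rule Bochner_Integration.integrable_bound)
    have "integrable lborel (\<lambda>t. complex_of_real (indicator {0..T} t))"
      by (intro integrable_of_real integrable_real_indicator) (use T in auto)
    then show "integrable (lborel \<Otimes>\<^sub>M lborel) (\<lambda>(t, \<zeta>). 1 * (complex_of_real (indicator {0..T} t) * M \<zeta>))"
      by (rule integrable_kernel[OF _ M, where B=1]) auto
    show "AE z in lborel \<Otimes>\<^sub>M lborel. norm (case_prod k z)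
        \<le> norm (case z of (t, \<zeta>) \<Rightarrow> 1 * (complex_of_real (indicator {0..T} t) * M \<zeta>))"
      using kM by (auto simp: norm_mult)
  qed (use km in simp)
  have V: "(LINT t:{0..T}|lborel. cis (- (T - t) * ?p \<zeta>) * ?G t \<zeta>) = (LINT t|lborel. k t \<zeta>)" for \<zeta>
    unfolding set_lebesgue_integral_def k_def ..
  have VI: "integrable lborel (\<lambda>\<zeta>. LINT t|lborel. k t \<zeta>)"
    using lborel_pair.integrable_snd[OF kI] .
  have vT: "v T (fourier h) = (LINT \<zeta>|lborel. (LINT t|lborel. k t \<zeta>) * h \<zeta>)" if h: "schwartz h" for h
  proof -
    note [measurable] = schwartz_measurable[OF h]
    obtain B where B: "\<And>z. norm (h z) \<le> B" using schwartz_bounded[OF h] by blast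
    have khI: "integrable (lborel \<Otimes>\<^sub>M lborel) (\<lambda>(t, \<zeta>). k t \<zeta> * h \<zeta>)"
      using integrable_bounded_mult[OF kI, of "\<lambda>z. h (snd z)" B] B
      by (simp add: case_prod_beta' mult.commute)
    have "v T (fourier h) = (LINT t|lborel. indicator {0..T} t *\<^sub>R U \<alpha> (T - t) (w t) (fourier h))"
      using v T schwartz_fourier[OF h] by (simp add: set_lebesgue_integral_def)
    also have "\<dots> = (LINT t|lborel. (LINT \<zeta>|lborel. k t \<zeta> * h \<zeta>))"
    proof (rule integral_cong_AE)
      \<comment> \<open>The definition gives \<open>w\<close> only as some family of distributions;
        measurability in time comes from the integrability clause of
        \<open>is_duhamel\<close>.\<close>
      show "(\<lambda>t. indicator {0..T} t *\<^sub>R U \<alpha> (T - t) (w t) (fourier h)) \<in> borel_measurable lborel"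
        using v[rule_format, of T] T schwartz_fourier[OF h]
        by (intro borel_measurable_integrable) (simp add: set_integrable_def)
      show "(\<lambda>t. LINT \<zeta>|lborel. k t \<zeta> * h \<zeta>) \<in> borel_measurable lborel"
        using lborel_pair.integrable_fst[OF khI] by auto
      show "AE t in lborel. indicator {0..T} t *\<^sub>R U \<alpha> (T - t) (w t) (fourier h) = (LINT \<zeta>|lborel. k t \<zeta> * h \<zeta>)"
        using w2
      proof eventually_elim
        case (elim t)
        show ?case
        proof (cases "t \<in> {0..T}")
          case True
          then show ?thesis
            using elim by (simp add: k_def inv_fourier_distr_def schwartz_fourier h fourier_inversion)
        next
          case False
          then show ?thesis by (simp add: k_def)
        qed
      qed
    qed
    also have "\<dots> = (LINT \<zeta>|lborel. (LINT t|lborel. k t \<zeta> * h \<zeta>))"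
      by (rule lborel_pair.Fubini_integral[OF khI, symmetric])
    finally show ?thesis by simp
  qed
  show ?thesis
    unfolding V has_fourier_fun_def using VI vT integrable_schwartz_mult[OF VI] by auto
qed

section \<open>A lower bound in the absence of oscillation\<close>

lemma cos_ge_half:
  assumes "\<bar>x\<bar> \<le> 1"
  shows "1 / 2 \<le> cos (x::real)"
proof -
  have "\<bar>x\<bar> \<le> pi / 3" using assms pi_gt3 by simp
  then have "cos (pi / 3) \<le> cos \<bar>x\<bar>"
    using pi_gt3 by (intro cos_monotone_0_pi_le) auto
  then show ?thesis by (simp add: cos_60)
qed

text \<open>Up to a unimodular factor independent of time, the integrand in \<omega> is a
  nonnegative kernel times \<open>cis\<close> of t times the resonance function. On the support of
  the kernel this angle is at most 1, where the cosine is at least 1/2, so the real parts add up.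
  The constant is T times 1/2 times \<open>1 / (2 * pi)\<^sup>2\<close>.\<close>

lemma duhamel_lower_bound:
  fixes r :: "plane \<Rightarrow> real"
  assumes T: "0 \<le> T" and [measurable]: "r \<in> borel_measurable borel"
    and kI: "integrable lborel (\<lambda>\<omega>. r \<omega> * ((\<zeta> - \<omega>) \<bullet> (1, 0) * r (\<zeta> - \<omega>)))"
    and k0: "\<And>\<omega>. 0 \<le> r \<omega> * ((\<zeta> - \<omega>) \<bullet> (1, 0) * r (\<zeta> - \<omega>))"
    and res: "\<And>\<omega>. r \<omega> \<noteq> 0 \<Longrightarrow> r (\<zeta> - \<omega>) \<noteq> 0 \<Longrightarrow>
      T * \<bar>disp_symbol \<alpha> \<zeta> - disp_symbol \<alpha> \<omega> - disp_symbol \<alpha> (\<zeta> - \<omega>)\<bar> \<le> 1"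
  shows "T / (8 * pi\<^sup>2) * (LINT \<omega>|lborel. r \<omega> * ((\<zeta> - \<omega>) \<bullet> (1, 0) * r (\<zeta> - \<omega>)))
    \<le> norm (LINT t:{0..T}|lborel. cis (- (T - t) * disp_symbol \<alpha> \<zeta>) * interaction \<alpha> (\<lambda>\<omega>. of_real (r \<omega>)) t \<zeta>)"
proof -
  let ?p = "disp_symbol \<alpha>"
  let ?k = "\<lambda>\<omega>. r \<omega> * ((\<zeta> - \<omega>) \<bullet> (1, 0) * r (\<zeta> - \<omega>))"
  let ?O = "\<lambda>\<omega>. ?p \<zeta> - ?p \<omega> - ?p (\<zeta> - \<omega>)"
  let ?K = "LINT \<omega>|lborel. ?k \<omega>"
  define J where "J t = (LINT \<omega>|lborel. cis (t * ?O \<omega>) * of_real (?k \<omega>))" for t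
  have JI: "integrable lborel (\<lambda>\<omega>. cis (t * ?O \<omega>) * of_real (?k \<omega>))" for t
    by (intro integrable_cis_mult integrable_of_real kI) measurable
  have Jm [measurable]: "J \<in> borel_measurable borel"
    unfolding J_def[abs_def] by measurable
  have JB: "norm (J t) \<le> ?K" for t
  proof -
    have "norm (J t) \<le> (LINT \<omega>|lborel. norm (cis (t * ?O \<omega>) * of_real (?k \<omega>)))"
      unfolding J_def by (rule integral_norm_bound)
    also have "\<dots> = ?K"
      using k0 by (intro Bochner_Integration.integral_cong) (simp_all only: norm_mult norm_cis norm_of_real, simp)
    finally show ?thesis .
  qed
  have JInt: "set_integrable lborel {0..T} J"
    unfolding set_integrable_def
  proof (rule integrableI_bounded_set_indicator[where B="?K"])
    show "AE x in lborel. x \<in> {0..T} \<longrightarrow> norm (J x) \<le> ?K" using JB by simp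
  qed (use T in auto)
  have ReJ: "?K / 2 \<le> Re (J t)" if t: "t \<in> {0..T}" for t
  proof -
    have "?K / 2 = (LINT \<omega>|lborel. ?k \<omega> / 2)" by simp
    also have "\<dots> \<le> (LINT \<omega>|lborel. Re (cis (t * ?O \<omega>) * of_real (?k \<omega>)))"
    proof (rule integral_mono)
      fix \<omega>
      show "?k \<omega> / 2 \<le> Re (cis (t * ?O \<omega>) * of_real (?k \<omega>))"
      proof (cases "?k \<omega> = 0")
        case False
        then have "T * \<bar>?O \<omega>\<bar> \<le> 1" using res by auto
        moreover have "\<bar>t * ?O \<omega>\<bar> \<le> T * \<bar>?O \<omega>\<bar>"
          using t by (simp add: abs_mult mult_right_mono)
        ultimately have "1 / 2 \<le> cos (t * ?O \<omega>)" by (intro cos_ge_half) linarith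
        from mult_right_mono[OF this k0[of \<omega>]] show ?thesis by simp
      next
        case True
        show ?thesis unfolding True by simp
      qed
    qed (intro integrable_divide_zero kI integrable_Re JI)+
    also have "\<dots> = Re (J t)" unfolding J_def by (rule integral_Re[OF JI])
    finally show ?thesis .
  qed
  \<comment> \<open>The phases of the group and of the two factors combine: at frequency \<zeta> the
    time dependence reduces to the resonance function, and \<open>cis (- T * ?p \<zeta>)\<close>
    comes out of the time integral.\<close>
  have eq: "cis (- (T - t) * ?p \<zeta>) * interaction \<alpha> (\<lambda>\<omega>. of_real (r \<omega>)) t \<zeta>
      = (\<i> * of_real (1 / (2 * pi)\<^sup>2) * cis (- T * ?p \<zeta>)) * J t" for t
  proof -
    have "interaction \<alpha> (\<lambda>\<omega>. of_real (r \<omega>)) t \<zeta> = of_real (1 / (2 * pi)\<^sup>2) *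
        (LINT \<omega>|lborel. (\<i> * cis (- t * ?p \<zeta>)) * (cis (t * ?O \<omega>) * of_real (?k \<omega>)))"
      unfolding interaction_def conv_def
    proof (rule arg_cong2[where f="(*)", OF refl Bochner_Integration.integral_cong[OF refl]])
      fix \<omega>
      have *: "cis (- t * ?p \<omega>) * cis (- t * ?p (\<zeta> - \<omega>)) = cis (- t * ?p \<zeta>) * cis (t * ?O \<omega>)"
        unfolding cis_mult by (simp add: algebra_simps)
      have "cis (- t * ?p \<omega>) * of_real (r \<omega>) *
            (\<i> * of_real ((\<zeta> - \<omega>) \<bullet> (1, 0)) * (cis (- t * ?p (\<zeta> - \<omega>)) * of_real (r (\<zeta> - \<omega>))))
          = \<i> * (cis (- t * ?p \<omega>) * cis (- t * ?p (\<zeta> - \<omega>))) * of_real (?k \<omega>)"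
        by (simp only: of_real_mult mult_ac)
      then show "cis (- t * ?p \<omega>) * of_real (r \<omega>) *
            (\<i> * of_real ((\<zeta> - \<omega>) \<bullet> (1, 0)) * (cis (- t * ?p (\<zeta> - \<omega>)) * of_real (r (\<zeta> - \<omega>))))
          = \<i> * cis (- t * ?p \<zeta>) * (cis (t * ?O \<omega>) * of_real (?k \<omega>))"
        unfolding * by (simp only: mult_ac)
    qed
    also have "\<dots> = of_real (1 / (2 * pi)\<^sup>2) * (\<i> * cis (- t * ?p \<zeta>) * J t)"
      unfolding J_def integral_mult_right_zero ..
    finally have "interaction \<alpha> (\<lambda>\<omega>. of_real (r \<omega>)) t \<zeta>
      = of_real (1 / (2 * pi)\<^sup>2) * (\<i> * cis (- t * ?p \<zeta>) * J t)" .
    moreover have "cis (- T * ?p \<zeta>) = cis (- (T - t) * ?p \<zeta>) * cis (- t * ?p \<zeta>)"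
      unfolding cis_mult by (simp add: algebra_simps)
    ultimately show ?thesis by simp
  qed
  have "T * (?K / 2) = (LINT t:{0..T}|lborel. ?K / 2)"
    using T by (simp add: set_lebesgue_integral_def)
  also have "\<dots> \<le> (LINT t:{0..T}|lborel. Re (J t))"
  proof (rule set_integral_mono)
    show "set_integrable lborel {0..T} (\<lambda>t. Re (J t))"
      using integrable_Re[OF JInt[unfolded set_integrable_def]] by (simp add: set_integrable_def)
    show "set_integrable lborel {0..T} (\<lambda>t. ?K / 2)"
      unfolding set_integrable_def
      by (intro integrable_scaleR_left integrable_real_indicator) (use T in auto)
  qed (rule ReJ)
  also have "\<dots> = Re (LINT t:{0..T}|lborel. J t)"
    using integral_Re[OF JInt[unfolded set_integrable_def]] by (simp add: set_lebesgue_integral_def)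
  also have "\<dots> \<le> norm (LINT t:{0..T}|lborel. J t)" by (rule complex_Re_le_cmod)
  finally have "T * (?K / 2) \<le> norm (LINT t:{0..T}|lborel. J t)" .
  then have "1 / (4 * pi\<^sup>2) * (T * (?K / 2)) \<le> 1 / (4 * pi\<^sup>2) * norm (LINT t:{0..T}|lborel. J t)"
    by (intro mult_left_mono) auto
  also have "\<dots> = norm (LINT t:{0..T}|lborel. cis (- (T - t) * ?p \<zeta>) * interaction \<alpha> (\<lambda>\<omega>. of_real (r \<omega>)) t \<zeta>)"
    unfolding eq by (simp add: norm_mult norm_divide norm_power power_mult_distrib)
  finally show ?thesis by simp
qed

section \<open>Sobolev norms\<close>

lemma sobolev_norm_sq:
  assumes "has_fourier_fun u g"
  shows "(sobolev_norm s u)\<^sup>2 = (LINT \<zeta>|lborel. (1 + (norm \<zeta>)\<^sup>2) powr s * (norm (g \<zeta>))\<^sup>2)"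
proof -
  note [measurable] = has_fourier_fun_measurable[OF assms]
    has_fourier_fun_measurable[OF has_fourier_fun_fourier_fun[OF assms]]
  have "(sobolev_norm s u)\<^sup>2 = (LINT \<zeta>|lborel. (1 + (norm \<zeta>)\<^sup>2) powr s * (norm (fourier_fun u \<zeta>))\<^sup>2)"
    unfolding sobolev_norm_def by simp
  also have "\<dots> = (LINT \<zeta>|lborel. (1 + (norm \<zeta>)\<^sup>2) powr s * (norm (g \<zeta>))\<^sup>2)"
    using AE_fourier_fun[OF assms] by (intro integral_cong_AE) auto
  finally show ?thesis .
qed

lemma sobolev_norm_nonneg: "0 \<le> sobolev_norm s u"
  unfolding sobolev_norm_def by simp

lemma sobolev_integrable:
  assumes "u \<in> sobolev s" "has_fourier_fun u g"
  shows "integrable lborel (\<lambda>\<zeta>. (1 + (norm \<zeta>)\<^sup>2) powr s * (norm (g \<zeta>))\<^sup>2)"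
proof -
  obtain g' where g': "has_fourier_fun u g'"
    "integrable lborel (\<lambda>\<zeta>. (1 + (norm \<zeta>)\<^sup>2) powr s * (norm (g' \<zeta>))\<^sup>2)"
    using assms(1) by (auto simp: sobolev_def)
  note [measurable] = has_fourier_fun_measurable[OF assms(2)] has_fourier_fun_measurable[OF g'(1)]
  have "AE \<zeta> in lborel. (1 + (norm \<zeta>)\<^sup>2) powr s * (norm (g' \<zeta>))\<^sup>2 = (1 + (norm \<zeta>)\<^sup>2) powr s * (norm (g \<zeta>))\<^sup>2"
    using has_fourier_fun_unique[OF g'(1) assms(2)] by auto
  then show ?thesis
    by (rule integrable_cong_AE[THEN iffD1, rotated 2, OF _ g'(2)]) measurable
qed

text \<open>A pointwise inequality for squares, integrated against the weight, stands in for the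
  triangle inequality. It suffices for local boundedness in time.\<close>

lemma sobolev_norm_le_diff:
  assumes u: "u \<in> sobolev s" and v: "v \<in> sobolev s"
  shows "(sobolev_norm s u)\<^sup>2 \<le> 2 * (sobolev_norm s (\<lambda>f. u f - v f))\<^sup>2 + 2 * (sobolev_norm s v)\<^sup>2"
proof -
  obtain a where a: "has_fourier_fun u a" using u by (auto simp: sobolev_def)
  obtain b where b: "has_fourier_fun v b" using v by (auto simp: sobolev_def)
  note [measurable] = has_fourier_fun_measurable[OF a] has_fourier_fun_measurable[OF b]
  let ?w = "\<lambda>\<zeta>::plane. (1 + (norm \<zeta>)\<^sup>2) powr s"
  have d: "has_fourier_fun (\<lambda>f. u f - v f) (\<lambda>\<zeta>. a \<zeta> - b \<zeta>)"
    using a b by (auto simp: has_fourier_fun_def left_diff_distrib)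
  note Ia = sobolev_integrable[OF u a] and Ib = sobolev_integrable[OF v b]
  have sq: "(norm (x - y))\<^sup>2 \<le> 2 * (norm x)\<^sup>2 + 2 * (norm y)\<^sup>2"
    "(norm x)\<^sup>2 \<le> 2 * (norm (x - y))\<^sup>2 + 2 * (norm y)\<^sup>2" for x y :: complex
  proof -
    have le: "p\<^sup>2 \<le> 2 * q\<^sup>2 + 2 * r\<^sup>2" if "0 \<le> p" "p \<le> q + r" for p q r :: real
    proof -
      have "p\<^sup>2 \<le> (q + r)\<^sup>2" using that by (intro power_mono)
      also have "\<dots> \<le> 2 * q\<^sup>2 + 2 * r\<^sup>2"
        using zero_le_power2[of "q - r"] by (simp add: power2_eq_square algebra_simps)
      finally show ?thesis .
    qed
    show "(norm (x - y))\<^sup>2 \<le> 2 * (norm x)\<^sup>2 + 2 * (norm y)\<^sup>2"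
      by (rule le) (auto intro: norm_triangle_ineq4)
    show "(norm x)\<^sup>2 \<le> 2 * (norm (x - y))\<^sup>2 + 2 * (norm y)\<^sup>2"
      using norm_triangle_ineq[of "x - y" y] by (intro le) auto
  qed
  \<comment> \<open>Without integrability the integral of the difference would default to 0 and
    bound nothing.\<close>
  have Id: "integrable lborel (\<lambda>\<zeta>. ?w \<zeta> * (norm (a \<zeta> - b \<zeta>))\<^sup>2)"
  proof (rule Bochner_Integration.integrable_bound)
    show "integrable lborel (\<lambda>\<zeta>. 2 * (?w \<zeta> * (norm (a \<zeta>))\<^sup>2) + 2 * (?w \<zeta> * (norm (b \<zeta>))\<^sup>2))"
      using Ia Ib by simp
    have "?w \<zeta> * (norm (a \<zeta> - b \<zeta>))\<^sup>2 \<le> 2 * (?w \<zeta> * (norm (a \<zeta>))\<^sup>2) + 2 * (?w \<zeta> * (norm (b \<zeta>))\<^sup>2)" for \<zeta>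
      using mult_left_mono[OF sq(1)[of "a \<zeta>" "b \<zeta>"], of "?w \<zeta>"] by (simp add: algebra_simps)
    then show "AE \<zeta> in lborel. norm (?w \<zeta> * (norm (a \<zeta> - b \<zeta>))\<^sup>2)
        \<le> norm (2 * (?w \<zeta> * (norm (a \<zeta>))\<^sup>2) + 2 * (?w \<zeta> * (norm (b \<zeta>))\<^sup>2))"
      by (intro always_eventually allI) simp
  qed measurable
  have "(LINT \<zeta>|lborel. ?w \<zeta> * (norm (a \<zeta>))\<^sup>2)
      \<le> (LINT \<zeta>|lborel. 2 * (?w \<zeta> * (norm (a \<zeta> - b \<zeta>))\<^sup>2) + 2 * (?w \<zeta> * (norm (b \<zeta>))\<^sup>2))"
  proof (rule integral_mono)
    fix \<zeta> show "?w \<zeta> * (norm (a \<zeta>))\<^sup>2 \<le> 2 * (?w \<zeta> * (norm (a \<zeta> - b \<zeta>))\<^sup>2) + 2 * (?w \<zeta> * (norm (b \<zeta>))\<^sup>2)"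
      using mult_left_mono[OF sq(2)[of "a \<zeta>" "b \<zeta>"], of "?w \<zeta>"] by (simp add: algebra_simps)
  qed (use Ia Ib Id in auto)
  then show ?thesis
    unfolding sobolev_norm_sq[OF a] sobolev_norm_sq[OF b] sobolev_norm_sq[OF d] using Ib Id by simp
qed

text \<open>Needed since the supremum of an unbounded set is a junk value.\<close>

lemma C_sobolev_bdd_above:
  assumes v: "v \<in> C_sobolev T s"
  shows "bdd_above ((\<lambda>t. sobolev_norm s (v t)) ` {0..T})"
proof (cases "0 \<le> T")
  case True
  let ?P = "\<lambda>a b. bdd_above ((\<lambda>t. sobolev_norm s (v t)) ` ({a..b} \<inter> {0..T}))"
  have "?P 0 T"
  \<comment> \<open>Compactness of the time interval by bisection: boundedness holds near each time
    and passes to unions of adjacent intervals. Intersecting with \<open>{0..T}\<close> handles the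
    endpoints.\<close>
  proof (rule Bolzano[where P="?P", OF True])
    fix a b c :: real assume "?P a b" "?P b c" "a \<le> b" "b \<le> c"
    then have "bdd_above ((\<lambda>t. sobolev_norm s (v t)) ` (({a..b} \<inter> {0..T}) \<union> ({b..c} \<inter> {0..T})))"
      unfolding image_Un by simp
    then show "?P a c"
      by (rule bdd_above_mono[OF _ image_mono]) auto
  next
    fix t assume t: "0 \<le> t" "t \<le> T"
    have vt: "v r \<in> sobolev s" if "r \<in> {0..T}" for r
      using v that by (auto simp: C_sobolev_def)
    have "((\<lambda>r. sobolev_norm s (\<lambda>f. v r f - v t f)) \<longlongrightarrow> 0) (at t within {0..T})"
      using v t by (auto simp: C_sobolev_def)
    then have "\<forall>\<^sub>F r in at t within {0..T}. sobolev_norm s (\<lambda>f. v r f - v t f) < 1"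
      by (rule order_tendstoD) simp
    then obtain d where d: "d > 0" "\<And>r. r \<in> {0..T} \<Longrightarrow> r \<noteq> t \<Longrightarrow> dist r t < d \<Longrightarrow>
        sobolev_norm s (\<lambda>f. v r f - v t f) < 1"
      unfolding eventually_at by blast
    have "?P a b" if ab: "a \<le> t \<and> t \<le> b \<and> b - a < d" for a b
    \<comment> \<open>The first summand covers \<open>r = t\<close>, the root all other
      times.\<close>
    proof (rule bdd_aboveI2[where M="sobolev_norm s (v t) + sqrt (2 + 2 * (sobolev_norm s (v t))\<^sup>2)"])
      fix r assume r: "r \<in> {a..b} \<inter> {0..T}"
      show "sobolev_norm s (v r) \<le> sobolev_norm s (v t) + sqrt (2 + 2 * (sobolev_norm s (v t))\<^sup>2)"
      proof (cases "r = t")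
        case False
        have "dist r t < d" using r ab by (auto simp: dist_real_def)
        then have "sobolev_norm s (\<lambda>f. v r f - v t f) \<le> 1"
          using d(2)[of r] r False by auto
        then have "(sobolev_norm s (\<lambda>f. v r f - v t f))\<^sup>2 \<le> 1"
          using sobolev_norm_nonneg by (intro power_le_one)
        then have "(sobolev_norm s (v r))\<^sup>2 \<le> 2 + 2 * (sobolev_norm s (v t))\<^sup>2"
          using sobolev_norm_le_diff[OF vt vt, of r t] r t by auto
        then show ?thesis
          using real_le_rsqrt sobolev_norm_nonneg[of s "v t"] by force
      qed simp
    qed
    with d(1) show "\<exists>d>0. \<forall>a b. a \<le> t \<and> t \<le> b \<and> b - a < d \<longrightarrow> ?P a b" by blast
  qed
  then show ?thesis by simp
qed simp

lemma sobolev_norm_le_C_sobolev_norm: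
  assumes "v \<in> C_sobolev T s" "t \<in> {0..T}"
  shows "sobolev_norm s (v t) \<le> C_sobolev_norm T s v"
  unfolding C_sobolev_norm_def by (rule cSUP_upper[OF assms(2) C_sobolev_bdd_above[OF assms(1)]])

section \<open>Norm inflation from a low-high interaction\<close>

text \<open>Superadditivity of x^(1 + \<alpha>) gives the sign. For the upper bound,
  \<open>\<alpha> \<le> 1\<close> enters twice, through (1 + a/b)^\<alpha> \<le> 1 + a/b and
  b^\<alpha> \<le> b; expanding leaves \<open>2 * a + a * (a / b)\<close>, at most
  \<open>3 * a\<close>.\<close>

lemma powr_resonance:
  fixes \<alpha> a b :: real
  assumes \<alpha>: "0 < \<alpha>" "\<alpha> \<le> 1" and a: "0 < a" "a \<le> b" and b: "1 \<le> b"
  shows "\<bar>(a + b) powr \<alpha> * (a + b) - a powr \<alpha> * a - b powr \<alpha> * b\<bar> \<le> 3 * a * b"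
proof -
  have "a powr \<alpha> * a + b powr \<alpha> * b \<le> (a + b) powr \<alpha> * a + (a + b) powr \<alpha> * b"
    using \<alpha> a b by (intro add_mono mult_right_mono powr_mono2) auto
  then have lower: "0 \<le> (a + b) powr \<alpha> * (a + b) - a powr \<alpha> * a - b powr \<alpha> * b"
    by (simp add: distrib_left)
  have "a + b = b * (1 + a / b)" using b by (simp add: field_simps)
  then have "(a + b) powr \<alpha> = b powr \<alpha> * (1 + a / b) powr \<alpha>"
    using a b by (metis add_nonneg_nonneg divide_nonneg_nonneg less_eq_real_def order_trans powr_mult zero_le_one)
  also have "\<dots> \<le> b powr \<alpha> * (1 + a / b)"
    using powr_mono[of \<alpha> 1 "1 + a / b"] \<alpha> a b by (intro mult_left_mono) auto
  finally have "(a + b) powr \<alpha> * (a + b) \<le> b powr \<alpha> * (1 + a / b) * (a + b)"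
    using a b by (intro mult_right_mono) auto
  also have "\<dots> = b powr \<alpha> * b + b powr \<alpha> * (2 * a + a * (a / b))"
    using b by (simp add: field_simps)
  also have "\<dots> \<le> b powr \<alpha> * b + b * (3 * a)"
  proof -
    have "b powr \<alpha> \<le> b" using powr_mono[of \<alpha> 1 b] \<alpha> b by simp
    moreover have "a * (a / b) \<le> a * 1" using a b by (intro mult_left_mono) auto
    ultimately show ?thesis using a b by (intro add_left_mono mult_mono) auto
  qed
  finally have "(a + b) powr \<alpha> * (a + b) - a powr \<alpha> * a - b powr \<alpha> * b \<le> 3 * a * b"
    using powr_ge_zero[of a \<alpha>] a by (smt (verit) mult_nonneg_nonneg mult.commute mult.left_commute)
  with lower show ?thesis by simp
qed

text \<open>Both first coordinates are positive, so all signs in the symbol equal 1 and the squares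
  of the second coordinates leave only their cross term.\<close>

lemma disp_resonance:
  assumes \<alpha>: "0 < \<alpha>" "\<alpha> \<le> 1" and a: "0 < fst \<omega>" "fst \<omega> \<le> fst \<omega>'" and b: "1 \<le> fst \<omega>'"
  shows "\<bar>disp_symbol \<alpha> (\<omega> + \<omega>') - disp_symbol \<alpha> \<omega> - disp_symbol \<alpha> \<omega>'\<bar>
    \<le> 3 * fst \<omega> * fst \<omega>' + 2 * \<bar>snd \<omega> * snd \<omega>'\<bar>"
proof -
  have p: "disp_symbol \<alpha> z = fst z powr \<alpha> * fst z + (snd z)\<^sup>2" if "0 < fst z" for z
    using that by (cases z) (simp add: disp_symbol_def)
  have "disp_symbol \<alpha> (\<omega> + \<omega>') - disp_symbol \<alpha> \<omega> - disp_symbol \<alpha> \<omega>'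
      = ((fst \<omega> + fst \<omega>') powr \<alpha> * (fst \<omega> + fst \<omega>') - fst \<omega> powr \<alpha> * fst \<omega> - fst \<omega>' powr \<alpha> * fst \<omega>')
        + 2 * (snd \<omega> * snd \<omega>')"
    using a by (simp add: p power2_eq_square algebra_simps)
  then show ?thesis using powr_resonance[OF \<alpha> a b] by linarith
qed

text \<open>The absolute value in the exponent treats both signs of \<open>s\<close> at once. The
  ratio 16 is what the rectangles allow: on the high ones 1 + |\<zeta>|^2 lies between N^2 and 16
  N^2, on the low one between 1 and 16.\<close>

lemma powr_comparable:
  fixes s :: real
  assumes M: "0 < M" "M \<le> x" "x \<le> 16 * M"
  shows "M powr s / 16 powr \<bar>s\<bar> \<le> x powr s" "x powr s \<le> 16 powr \<bar>s\<bar> * M powr s"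
proof -
  define y where "y = x / M"
  have y: "1 \<le> y" "y \<le> 16" using M by (auto simp: y_def field_simps)
  have x: "x powr s = M powr s * y powr s"
    using M powr_mult[of M y s] by (simp add: y_def)
  have 1: "y powr \<bar>s\<bar> \<le> 16 powr \<bar>s\<bar>" using y by (intro powr_mono2) auto
  have "y powr s \<le> y powr \<bar>s\<bar>" using y by (intro powr_mono) auto
  with 1 show "x powr s \<le> 16 powr \<bar>s\<bar> * M powr s"
    unfolding x by (subst mult.commute) (intro mult_right_mono, auto)
  have "1 / 16 powr \<bar>s\<bar> \<le> 1 / y powr \<bar>s\<bar>" using 1 y by (intro divide_left_mono) auto
  also have "\<dots> = y powr (- \<bar>s\<bar>)" by (simp add: powr_minus_divide)
  also have "\<dots> \<le> y powr s" using y by (intro powr_mono) auto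
  finally show "M powr s / 16 powr \<bar>s\<bar> \<le> x powr s"
    unfolding x using mult_left_mono[of "1 / 16 powr \<bar>s\<bar>" "y powr s" "M powr s"] by simp
qed

section \<open>Rectangles in the frequency plane and norm inflation\<close>

lemma rectangle_eq_cbox: "{a..b} \<times> {c..d} = (cbox (a, c) (b, d) :: plane set)"
  by (simp add: cbox_Pair_eq)

lemma measure_rectangle:
  assumes "a \<le> b" "c \<le> d"
  shows "measure lborel ({a..b} \<times> {c..d} :: plane set) = (b - a) * (d - c)"
  unfolding rectangle_eq_cbox content_Pair using assms by simp

lemma integrable_indicator_rectangle:
  "integrable lborel (indicator ({a..b} \<times> {c..d}) :: plane \<Rightarrow> real)"
  unfolding rectangle_eq_cbox
  by (intro integrable_real_indicator emeasure_lborel_cbox_finite) simp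

text \<open>\<open>q\<close> is the area of the low rectangle. The squared output divided by the
  fourth power of the data norm is at least of order \<open>N\<^sup>2 * q\<close>, hence of order
  \<open>N\<close> for fixed \<open>T\<close>. The bound is for every Duhamel term \<open>v\<close>,
  because the assumed estimate provides one without naming it.\<close>

lemma norm_inflation:
  fixes \<alpha> s T N :: real
  assumes \<alpha>: "0 < \<alpha>" "\<alpha> \<le> 1" and T: "0 < T" and N: "4 \<le> N" "1 \<le> 32 * T * N"
  defines "q \<equiv> 1 / (32 * T * N) * (1 / (1 + 8 * T))"
  shows "\<exists>\<phi>\<in>sobolev s. (sobolev_norm s \<phi>)\<^sup>2 \<le> 5 * 16 powr \<bar>s\<bar> * q \<and>
    (\<forall>v. is_duhamel \<alpha> T (on_interval T (\<lambda>t. U \<alpha> t \<phi>)) v \<longrightarrow> v T \<in> sobolev s \<longrightarrow>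
      (T / (8 * pi\<^sup>2))\<^sup>2 * N\<^sup>2 * q ^ 3 / 16 powr \<bar>s\<bar> \<le> (sobolev_norm s (v T))\<^sup>2)"
proof -
  \<comment> \<open>The resonance function will be at most
    \<open>12 * \<gamma> * N + 4 * \<beta>\<^sup>2\<close>; \<open>\<gamma>\<close> and
    \<open>\<beta>\<close> are chosen so that each term times \<open>T\<close> is at most 1/2. The
    summand 1 in \<open>1 + 8 * T\<close> keeps \<open>\<beta>\<close> below 1 for small
    \<open>T\<close>, so that \<open>\<beta>\<^sup>2 \<le> \<beta>\<close>.\<close>
  define \<gamma> where "\<gamma> = 1 / (32 * T * N)"
  define \<beta> where "\<beta> = 1 / (1 + 8 * T)"
  have \<gamma>: "0 < \<gamma>" "\<gamma> \<le> 1" "T * (12 * \<gamma> * N) \<le> 1 / 2"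
    using T N by (auto simp: \<gamma>_def)
  have \<beta>: "0 < \<beta>" "\<beta> \<le> 1" "T * (4 * \<beta>\<^sup>2) \<le> 1 / 2"
  proof -
    show b: "0 < \<beta>" "\<beta> \<le> 1" using T by (auto simp: \<beta>_def)
    have "\<beta>\<^sup>2 \<le> \<beta>" using b by (simp add: power2_eq_square mult_left_le_one_le)
    then have "T * (4 * \<beta>\<^sup>2) \<le> T * (4 * \<beta>)" using T by simp
    also have "\<dots> \<le> 1 / 2" using T by (simp add: \<beta>_def divide_simps)
    finally show "T * (4 * \<beta>\<^sup>2) \<le> 1 / 2" .
  qed
  have q: "q = \<gamma> * \<beta>" by (simp add: q_def \<gamma>_def \<beta>_def)
  define D where "D = 16 powr \<bar>s\<bar>"
  \<comment> \<open>The amplitude that makes the high piece, weighted by about N^(2s), comparable to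
    the low one; \<open>NB\<close> records the cancellation.\<close>
  define B where "B = 1 / N powr s"
  have D: "0 < D" by (simp add: D_def)
  have B: "0 < B" using N by (simp add: B_def)
  have NB: "(N\<^sup>2) powr s * B\<^sup>2 = 1"
    using N powr_mult[of N N s] by (simp add: B_def power2_eq_square)
  text \<open>\<open>\<zeta> \<in> R\<close> and \<open>\<omega> \<in> L\<close> imply \<open>\<zeta> - \<omega> \<in> H\<close>; sums of two points of \<open>L\<close> or of \<open>H\<close> miss \<open>R\<close>.\<close>
  define L where "L = {\<gamma>..2 * \<gamma>} \<times> {0..\<beta>}"
  define H where "H = {N..N + 2 * \<gamma>} \<times> {0..2 * \<beta>}"
  define R where "R = {N + 2 * \<gamma>..N + 3 * \<gamma>} \<times> {\<beta>..2 * \<beta>}"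
  have L: "\<omega> \<in> L \<longleftrightarrow> \<gamma> \<le> fst \<omega> \<and> fst \<omega> \<le> 2 * \<gamma> \<and> 0 \<le> snd \<omega> \<and> snd \<omega> \<le> \<beta>" for \<omega>
    by (auto simp: L_def mem_Times_iff)
  have H: "\<omega> \<in> H \<longleftrightarrow> N \<le> fst \<omega> \<and> fst \<omega> \<le> N + 2 * \<gamma> \<and> 0 \<le> snd \<omega> \<and> snd \<omega> \<le> 2 * \<beta>" for \<omega>
    by (auto simp: H_def mem_Times_iff)
  have R: "\<omega> \<in> R \<longleftrightarrow> N + 2 * \<gamma> \<le> fst \<omega> \<and> fst \<omega> \<le> N + 3 * \<gamma> \<and> \<beta> \<le> snd \<omega> \<and> snd \<omega> \<le> 2 * \<beta>" for \<omega>
    by (auto simp: R_def mem_Times_iff)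
  have int: "integrable lborel (indicator L :: plane \<Rightarrow> real)" "integrable lborel (indicator H :: plane \<Rightarrow> real)"
    "integrable lborel (indicator R :: plane \<Rightarrow> real)"
    unfolding L_def H_def R_def by (rule integrable_indicator_rectangle)+
  then have [measurable]: "L \<in> sets borel" "H \<in> sets borel" "R \<in> sets borel"
    unfolding L_def H_def R_def rectangle_eq_cbox by auto
  have meas: "measure lborel L = \<gamma> * \<beta>" "measure lborel H = 4 * (\<gamma> * \<beta>)" "measure lborel R = \<gamma> * \<beta>"
    unfolding L_def H_def R_def using \<gamma> \<beta> by (subst measure_rectangle; simp)+
  define r where "r \<omega> = indicator L \<omega> + B * indicator H \<omega>" for \<omega> :: plane
  have rI: "integrable lborel r" unfolding r_def[abs_def] using int by simp
  have [measurable]: "r \<in> borel_measurable borel" unfolding r_def[abs_def] by measurable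
  have disj: "L \<inter> H = {}" using L H \<gamma> N by force
  have r_L: "r \<omega> = 1" if "\<omega> \<in> L" for \<omega> using that disj by (auto simp: r_def indicator_def)
  have r_H: "r \<omega> = B" if "\<omega> \<in> H" for \<omega> using that disj by (auto simp: r_def indicator_def)
  have r_0: "r \<omega> = 0" if "\<omega> \<notin> L" "\<omega> \<notin> H" for \<omega> using that by (simp add: r_def)
  have r0: "0 \<le> r \<omega>" for \<omega> using B by (simp add: r_def)
  have r1: "r \<omega> \<le> 1 + B" for \<omega> using B by (auto simp: r_def indicator_def)
  \<comment> \<open>The support lies in 0 \<le> \<xi> \<le> N + 3: the symbol of the derivative is
    bounded there, and its sign rules out cancellation in the convolution.\<close>
  have xr: "0 \<le> fst \<omega> * r \<omega>" "fst \<omega> * r \<omega> \<le> (N + 3) * r \<omega>" for \<omega>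
  proof -
    have "0 \<le> fst \<omega> \<and> fst \<omega> \<le> N + 3" if "r \<omega> \<noteq> 0"
    proof -
      have "\<omega> \<in> L \<or> \<omega> \<in> H" using r_0 that by blast
      then show ?thesis using L H \<gamma> N by auto
    qed
    then show "0 \<le> fst \<omega> * r \<omega>" "fst \<omega> * r \<omega> \<le> (N + 3) * r \<omega>"
      using r0[of \<omega>] by (cases "r \<omega> = 0"; simp add: mult_right_mono)+
  qed
  have fst_eq: "z \<bullet> (1, 0) = fst z" for z :: plane by (simp add: inner_prod_def)
  let ?g = "\<lambda>\<omega>. complex_of_real (r \<omega>)"
  have gI: "integrable lborel ?g" using rI by simp
  have xgI: "integrable lborel (\<lambda>\<zeta>. of_real (\<zeta> \<bullet> (1, 0)) * ?g \<zeta>)"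
  proof (rule Bochner_Integration.integrable_bound)
    show "integrable lborel (\<lambda>\<zeta>. (N + 3) * r \<zeta>)" using rI by simp
    show "AE \<zeta> in lborel. norm (of_real (\<zeta> \<bullet> (1, 0)) * ?g \<zeta>) \<le> norm ((N + 3) * r \<zeta>)"
      using xr r0 N by (intro always_eventually allI)
        (simp add: fst_eq abs_mult[symmetric] norm_mult[symmetric] del: norm_mult of_real_mult flip: of_real_mult)
  qed measurable
  define \<phi> where "\<phi> = inv_fourier_distr ?g"
  have \<phi>: "has_fourier_fun \<phi> ?g" unfolding \<phi>_def by (rule has_fourier_fun_inv_fourier_distr[OF gI])
  let ?w = "\<lambda>\<zeta>::plane. (1 + (norm \<zeta>)\<^sup>2) powr s"
  \<comment> \<open>The box contains both \<open>H\<close> and \<open>R\<close>, so one comparison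
    serves the data and the output.\<close>
  have w_high: "(N\<^sup>2) powr s / D \<le> ?w \<zeta>" "?w \<zeta> \<le> D * (N\<^sup>2) powr s"
    if "N \<le> fst \<zeta>" "fst \<zeta> \<le> N + 3 * \<gamma>" "0 \<le> snd \<zeta>" "snd \<zeta> \<le> 2 * \<beta>" for \<zeta> :: plane
  proof -
    have "N\<^sup>2 \<le> (fst \<zeta>)\<^sup>2" using that N by (intro power_mono) auto
    then have 1: "N\<^sup>2 \<le> 1 + (norm \<zeta>)\<^sup>2" 
      using zero_le_power2[of "snd \<zeta>"] unfolding norm_plane by linarith
    have "(fst \<zeta>)\<^sup>2 \<le> (2 * N)\<^sup>2" using that N \<gamma> by (intro power_mono) auto
    moreover have "(snd \<zeta>)\<^sup>2 \<le> 2\<^sup>2" using that \<beta> by (intro power_mono) auto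
    moreover have "4\<^sup>2 \<le> N\<^sup>2" using N by (intro power_mono) auto
    ultimately have 2: "1 + (norm \<zeta>)\<^sup>2 \<le> 16 * N\<^sup>2" by (simp add: norm_plane power_mult_distrib)
    show "(N\<^sup>2) powr s / D \<le> ?w \<zeta>" "?w \<zeta> \<le> D * (N\<^sup>2) powr s"
      using powr_comparable[OF _ 1 2, of s] N by (auto simp: D_def)
  qed
  have w_low: "?w \<zeta> \<le> D" if "\<zeta> \<in> L" for \<zeta>
  proof -
    have "0 \<le> fst \<zeta>" "fst \<zeta> \<le> 2" "0 \<le> snd \<zeta>" "snd \<zeta> \<le> 1" using that \<gamma> \<beta> unfolding L by auto
    then have "(fst \<zeta>)\<^sup>2 \<le> 2\<^sup>2" "(snd \<zeta>)\<^sup>2 \<le> 1\<^sup>2" by (auto simp only: intro!: power_mono)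
    then show ?thesis
      using powr_comparable(2)[of 1 "1 + (norm \<zeta>)\<^sup>2" s] by (simp add: norm_plane D_def)
  qed
  have wr: "?w \<zeta> * (norm (?g \<zeta>))\<^sup>2 \<le> D * (indicator L \<zeta> + indicator H \<zeta>)" for \<zeta>
  proof -
    consider "\<zeta> \<in> L" | "\<zeta> \<in> H" | "\<zeta> \<notin> L" "\<zeta> \<notin> H" by blast
    then show ?thesis
    proof cases
      case 1
      then have "\<zeta> \<notin> H" using disj by blast
      then show ?thesis using 1 w_low[OF 1] r_L[OF 1] by simp
    next
      case 2
      then have "\<zeta> \<notin> L" using disj by blast
      moreover have "?w \<zeta> \<le> D * (N\<^sup>2) powr s" using 2 H \<gamma> by (intro w_high(2)) auto
      then have "?w \<zeta> * B\<^sup>2 \<le> D * (N\<^sup>2) powr s * B\<^sup>2" by (intro mult_right_mono) auto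
      then have "?w \<zeta> * B\<^sup>2 \<le> D" by (simp only: mult.assoc NB mult_1_right)
      ultimately show ?thesis using 2 r_H[OF 2] by simp
    next
      case 3
      then show ?thesis using r_0 by simp
    qed
  qed
  have wI: "integrable lborel (\<lambda>\<zeta>. D * (indicator L \<zeta> + indicator H \<zeta>))"
    using int by simp
  have wrI: "integrable lborel (\<lambda>\<zeta>. ?w \<zeta> * (norm (?g \<zeta>))\<^sup>2)"
    by (rule Bochner_Integration.integrable_bound[OF wI])
      (use wr in \<open>auto intro!: always_eventually order_trans[OF wr abs_ge_self] simp del: norm_of_real\<close>)
  have "\<phi> \<in> sobolev s"
    unfolding sobolev_def using \<phi> wrI tempered_inv_fourier_distr[OF gI] by (auto simp: \<phi>_def)
  moreover have "(sobolev_norm s \<phi>)\<^sup>2 \<le> 5 * 16 powr \<bar>s\<bar> * q"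
  proof -
    have "(sobolev_norm s \<phi>)\<^sup>2 \<le> (LINT \<zeta>|lborel. D * (indicator L \<zeta> + indicator H \<zeta>))"
      unfolding sobolev_norm_sq[OF \<phi>] by (rule integral_mono[OF wrI wI wr])
    \<comment> \<open>\<open>L\<close> has area \<open>q\<close> and \<open>H\<close>, with both
      sides doubled, area \<open>4 * q\<close>.\<close>
    also have "\<dots> = 5 * D * q" using int by (simp add: meas q)
    finally show ?thesis by (simp add: D_def)
  qed
  moreover have "(T / (8 * pi\<^sup>2))\<^sup>2 * N\<^sup>2 * q ^ 3 / 16 powr \<bar>s\<bar> \<le> (sobolev_norm s (v T))\<^sup>2"
    if duh: "is_duhamel \<alpha> T (on_interval T (\<lambda>t. U \<alpha> t \<phi>)) v" and vT: "v T \<in> sobolev s" for v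
  proof -
    define V where "V \<zeta> = (LINT t:{0..T}|lborel.
      cis (- (T - t) * disp_symbol \<alpha> \<zeta>) * interaction \<alpha> ?g t \<zeta>)" for \<zeta>
    have V: "has_fourier_fun (v T) V"
      using duhamel_fourier[OF gI xgI _ duh[unfolded \<phi>_def]] T unfolding V_def[abs_def] by simp
    have V_lower: "T / (8 * pi\<^sup>2) * (N * B * q) \<le> norm (V \<zeta>)" if \<zeta>: "\<zeta> \<in> R" for \<zeta>
    proof -
      let ?k = "\<lambda>\<omega>. r \<omega> * ((\<zeta> - \<omega>) \<bullet> (1, 0) * r (\<zeta> - \<omega>))"
      have k0: "0 \<le> ?k \<omega>" for \<omega>
        unfolding fst_eq by (rule mult_nonneg_nonneg[OF r0 xr(1)])
      have kI: "integrable lborel ?k"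
      proof (rule Bochner_Integration.integrable_bound)
        show "integrable lborel (\<lambda>\<omega>. r \<omega> * ((N + 3) * (1 + B)))" using rI by simp
        have "?k \<omega> \<le> r \<omega> * ((N + 3) * (1 + B))" for \<omega>
          unfolding fst_eq using N
          by (intro mult_left_mono r0 order_trans[OF xr(2)] r1) auto
        then show "AE \<omega> in lborel. norm (?k \<omega>) \<le> norm (r \<omega> * ((N + 3) * (1 + B)))"
          using k0 by (intro always_eventually allI) (smt (verit) real_norm_def)
      qed measurable
      have low_high: "T * \<bar>disp_symbol \<alpha> (\<omega> + \<omega>') - disp_symbol \<alpha> \<omega> - disp_symbol \<alpha> \<omega>'\<bar> \<le> 1"
        if "\<omega> \<in> L" "\<omega>' \<in> H" for \<omega> \<omega>'
      proof -
        have \<omega>: "\<gamma> \<le> fst \<omega>" "fst \<omega> \<le> 2 * \<gamma>" "\<bar>snd \<omega>\<bar> \<le> \<beta>"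
          and \<omega>': "N \<le> fst \<omega>'" "fst \<omega>' \<le> 2 * N" "\<bar>snd \<omega>'\<bar> \<le> 2 * \<beta>"
          using that \<gamma>(2) N unfolding L H by auto
        have "\<bar>disp_symbol \<alpha> (\<omega> + \<omega>') - disp_symbol \<alpha> \<omega> - disp_symbol \<alpha> \<omega>'\<bar>
            \<le> 3 * fst \<omega> * fst \<omega>' + 2 * \<bar>snd \<omega> * snd \<omega>'\<bar>"
          by (rule disp_resonance[OF \<alpha>]) (use \<omega> \<omega>' \<gamma> N in linarith)+
        also have "\<dots> \<le> 3 * (2 * \<gamma>) * (2 * N) + 2 * (\<beta> * (2 * \<beta>))"
          unfolding abs_mult
          by (intro add_mono mult_mono) (use \<omega> \<omega>' \<gamma>(1) N \<beta>(1) in linarith | simp)+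
        finally have "T * \<bar>disp_symbol \<alpha> (\<omega> + \<omega>') - disp_symbol \<alpha> \<omega> - disp_symbol \<alpha> \<omega>'\<bar>
            \<le> T * (12 * \<gamma> * N + 4 * \<beta>\<^sup>2)"
          using T by (intro mult_left_mono) (auto simp: power2_eq_square)
        also have "\<dots> \<le> 1" unfolding distrib_left using \<gamma>(3) \<beta>(3) by linarith
        finally show ?thesis .
      qed
      \<comment> \<open>Either factor may be the low one. The resonance function is symmetric in the
        two frequencies, so \<open>low_high\<close> covers both orders.\<close>
      have res: "T * \<bar>disp_symbol \<alpha> \<zeta> - disp_symbol \<alpha> \<omega> - disp_symbol \<alpha> (\<zeta> - \<omega>)\<bar> \<le> 1"
        if nz: "r \<omega> \<noteq> 0" "r (\<zeta> - \<omega>) \<noteq> 0" for \<omega>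
      proof -
        have "\<omega> \<in> L \<or> \<omega> \<in> H" "\<zeta> - \<omega> \<in> L \<or> \<zeta> - \<omega> \<in> H" using nz r_0 by blast+
        moreover have "\<not> (\<omega> \<in> L \<and> \<zeta> - \<omega> \<in> L)" "\<not> (\<omega> \<in> H \<and> \<zeta> - \<omega> \<in> H)"
          using \<zeta> \<gamma> N unfolding L H R by auto
        ultimately consider "\<omega> \<in> L" "\<zeta> - \<omega> \<in> H" | "\<zeta> - \<omega> \<in> L" "\<omega> \<in> H" by blast
        then show ?thesis
        proof cases
          case 1
          from low_high[OF this] show ?thesis by simp
        next
          case 2
          from low_high[OF this] show ?thesis by (simp add: algebra_simps)
        qed
      qed
      \<comment> \<open>Keeping only \<open>\<omega> \<in> L\<close> discards nonnegative terms.
        There the derivative falls on the high factor and gives at least \<open>N\<close>, with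
        amplitude \<open>B\<close>, over an area \<open>q\<close>.\<close>
      have "N * B * q = (LINT \<omega>|lborel. N * B * indicator L \<omega>)" by (simp add: meas q)
      also have "\<dots> \<le> (LINT \<omega>|lborel. ?k \<omega>)"
      proof (rule integral_mono)
        fix \<omega>
        show "N * B * indicator L \<omega> \<le> ?k \<omega>"
        proof (cases "\<omega> \<in> L")
          case True
          then have H': "\<zeta> - \<omega> \<in> H" using \<zeta> unfolding L H R by auto
          then have "N \<le> fst (\<zeta> - \<omega>)" using H by blast
          then show ?thesis
            unfolding fst_eq r_L[OF True] r_H[OF H'] using True B by (simp add: mult_right_mono)
        next
          case False
          then show ?thesis using k0[of \<omega>] by simp
        qed
      qed (use int kI in auto)
      finally have "T / (8 * pi\<^sup>2) * (N * B * q) \<le> T / (8 * pi\<^sup>2) * (LINT \<omega>|lborel. ?k \<omega>)"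
        using T by (intro mult_left_mono) auto
      also have "\<dots> \<le> norm (V \<zeta>)"
        unfolding V_def by (rule duhamel_lower_bound[OF _ _ kI k0 res]) (use T in auto)
      finally show ?thesis .
    qed
    let ?c = "(N\<^sup>2) powr s / D * (T / (8 * pi\<^sup>2) * (N * B * q))\<^sup>2"
    have q0: "0 < q" using \<gamma> \<beta> by (simp add: q)
    \<comment> \<open>The weight on \<open>R\<close> and the square of the amplitude
      \<open>B\<close> cancel by \<open>NB\<close>, which removes every power of \<open>N\<close>
      that depends on \<open>s\<close>.\<close>
    have "(T / (8 * pi\<^sup>2))\<^sup>2 * N\<^sup>2 * q ^ 3 / D = ?c * q"
    proof -
      have "?c * q = ((N\<^sup>2) powr s * B\<^sup>2) * ((T / (8 * pi\<^sup>2))\<^sup>2 * N\<^sup>2 * q ^ 3 / D)"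
        by (simp add: power_mult_distrib power2_eq_square power3_eq_cube mult_ac)
      then show ?thesis unfolding NB mult_1_left by (rule sym)
    qed
    also have "\<dots> = (LINT \<zeta>|lborel. ?c * indicator R \<zeta>)" by (simp add: meas q)
    also have "\<dots> \<le> (LINT \<zeta>|lborel. ?w \<zeta> * (norm (V \<zeta>))\<^sup>2)"
    proof (rule integral_mono)
      fix \<zeta>
      show "?c * indicator R \<zeta> \<le> ?w \<zeta> * (norm (V \<zeta>))\<^sup>2"
      proof (cases "\<zeta> \<in> R")
        case True
        have "(N\<^sup>2) powr s / D \<le> ?w \<zeta>" using True \<gamma> \<beta> unfolding R by (intro w_high(1)) auto
        moreover have "(T / (8 * pi\<^sup>2) * (N * B * q))\<^sup>2 \<le> (norm (V \<zeta>))\<^sup>2"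
          using T N B q0 by (intro power_mono V_lower True) auto
        ultimately have "?c \<le> ?w \<zeta> * (norm (V \<zeta>))\<^sup>2" by (intro mult_mono) auto
        then show ?thesis using True by simp
      qed simp
    qed (use int sobolev_integrable[OF vT V] in auto)
    also have "\<dots> = (sobolev_norm s (v T))\<^sup>2" by (rule sobolev_norm_sq[OF V, symmetric])
    finally show ?thesis by (simp add: D_def)
  qed
  ultimately show ?thesis by blast
qed

section \<open>Contradiction as the frequency N grows\<close>

theorem proposition2p1:
  fixes \<alpha> s T :: real
  assumes "0 < \<alpha>" and "\<alpha> \<le> 1" and "0 < T"
  shows "\<not> (\<exists>X nrm. normed_space_on X nrm \<and> continuously_embedded X nrm T s \<and>
    (\<exists>C>0.
      (\<forall>\<phi>\<in>sobolev s. on_interval T (\<lambda>t. U \<alpha> t \<phi>) \<in> X \<and>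
         nrm (on_interval T (\<lambda>t. U \<alpha> t \<phi>)) \<le> C * sobolev_norm s \<phi>) \<and>
      (\<forall>u\<in>X. \<exists>v\<in>X. is_duhamel \<alpha> T u v \<and> nrm v \<le> C * (nrm u)\<^sup>2)))"
proof
  assume "\<exists>X nrm. normed_space_on X nrm \<and> continuously_embedded X nrm T s \<and>
    (\<exists>C>0.
      (\<forall>\<phi>\<in>sobolev s. on_interval T (\<lambda>t. U \<alpha> t \<phi>) \<in> X \<and>
         nrm (on_interval T (\<lambda>t. U \<alpha> t \<phi>)) \<le> C * sobolev_norm s \<phi>) \<and>
      (\<forall>u\<in>X. \<exists>v\<in>X. is_duhamel \<alpha> T u v \<and> nrm v \<le> C * (nrm u)\<^sup>2))"
  then obtain X nrm C where nrm: "normed_space_on X nrm" and emb: "continuously_embedded X nrm T s"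
    and C: "0 < C"
    and lin: "\<And>\<phi>. \<phi> \<in> sobolev s \<Longrightarrow> on_interval T (\<lambda>t. U \<alpha> t \<phi>) \<in> X \<and>
         nrm (on_interval T (\<lambda>t. U \<alpha> t \<phi>)) \<le> C * sobolev_norm s \<phi>"
    and bil: "\<And>u. u \<in> X \<Longrightarrow> \<exists>v\<in>X. is_duhamel \<alpha> T u v \<and> nrm v \<le> C * (nrm u)\<^sup>2"
    by auto
  have nrm0: "0 \<le> nrm u" if "u \<in> X" for u
    using nrm that by (auto simp: normed_space_on_def)
  obtain K where XC: "X \<subseteq> C_sobolev T s" and K: "\<And>u. u \<in> X \<Longrightarrow> C_sobolev_norm T s u \<le> K * nrm u"
    using emb by (auto simp: continuously_embedded_def)
  \<comment> \<open>The constant of the chain embedding, bilinear estimate, squared linear estimate.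
    The absolute value is taken because the embedding constant \<open>K\<close> comes without a
    sign.\<close>
  define C' where "C' = \<bar>K\<bar> * (C * C\<^sup>2)"
  define D where "D = 16 powr \<bar>s\<bar>"
  \<comment> \<open>What remains of the lower bound per unit of \<open>N\<close>, as
    \<open>N\<^sup>2 * q = N / (32 * T * (1 + 8 * T))\<close>.\<close>
  define c where "c = (T / (8 * pi\<^sup>2))\<^sup>2 / (32 * T * (1 + 8 * T))"
  have D: "0 < D" by (simp add: D_def)
  have c: "0 < c" using \<open>0 < T\<close> by (simp add: c_def)
  have main: "c * N \<le> 25 * C'\<^sup>2 * D ^ 3" if N: "4 \<le> N" "1 \<le> 32 * T * N" for N
  proof -
    define q where "q = 1 / (32 * T * N) * (1 / (1 + 8 * T))"
    have q: "0 < q" using \<open>0 < T\<close> N by (simp add: q_def)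
    obtain \<phi> where \<phi>: "\<phi> \<in> sobolev s" "(sobolev_norm s \<phi>)\<^sup>2 \<le> 5 * D * q"
      and infl: "\<And>v. is_duhamel \<alpha> T (on_interval T (\<lambda>t. U \<alpha> t \<phi>)) v \<Longrightarrow> v T \<in> sobolev s \<Longrightarrow>
        (T / (8 * pi\<^sup>2))\<^sup>2 * N\<^sup>2 * q ^ 3 / D \<le> (sobolev_norm s (v T))\<^sup>2"
      using norm_inflation[OF assms N, of s] unfolding q_def[symmetric] D_def[symmetric] by blast
    let ?u = "on_interval T (\<lambda>t. U \<alpha> t \<phi>)"
    have u: "?u \<in> X" "nrm ?u \<le> C * sobolev_norm s \<phi>" using lin[OF \<phi>(1)] by auto
    obtain v where v: "v \<in> X" "is_duhamel \<alpha> T ?u v" "nrm v \<le> C * (nrm ?u)\<^sup>2" using bil[OF u(1)] by blast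
    have vC: "v \<in> C_sobolev T s" using v(1) XC by blast
    have T: "T \<in> {0..T}" using \<open>0 < T\<close> by simp
    have vT: "v T \<in> sobolev s" using vC T by (auto simp: C_sobolev_def)
    have "sobolev_norm s (v T) \<le> K * nrm v"
      using sobolev_norm_le_C_sobolev_norm[OF vC T] K[OF v(1)] by linarith
    also have "\<dots> \<le> \<bar>K\<bar> * nrm v" using nrm0[OF v(1)] by (intro mult_right_mono) auto
    also have "\<dots> \<le> \<bar>K\<bar> * (C * (C * sobolev_norm s \<phi>)\<^sup>2)"
      using C v(3) u(2) nrm0[OF u(1)]
      by (intro mult_left_mono order_trans[OF v(3)] power_mono) auto
    also have "\<dots> = C' * (sobolev_norm s \<phi>)\<^sup>2" by (simp add: C'_def power_mult_distrib)
    also have "\<dots> \<le> C' * (5 * D * q)"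
      using \<phi>(2) C by (intro mult_left_mono) (auto simp: C'_def)
    finally have "(sobolev_norm s (v T))\<^sup>2 \<le> (C' * (5 * D * q))\<^sup>2"
      using sobolev_norm_nonneg by (intro power_mono)
    with infl[OF v(2) vT] have "(T / (8 * pi\<^sup>2))\<^sup>2 * N\<^sup>2 * q ^ 3 / D \<le> (C' * (5 * D * q))\<^sup>2" by simp
    then have "(T / (8 * pi\<^sup>2))\<^sup>2 * N\<^sup>2 * q ^ 3 \<le> (C' * (5 * D * q))\<^sup>2 * D"
      using D by (simp add: divide_le_eq)
    \<comment> \<open>The right-hand side is quadratic in \<open>q\<close> and the left-hand side
      cubic; dividing by \<open>q\<^sup>2\<close> leaves \<open>N\<^sup>2 * q\<close>, which is
      linear in \<open>N\<close>.\<close>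
    then have "((T / (8 * pi\<^sup>2))\<^sup>2 * N\<^sup>2 * q) * q\<^sup>2 \<le> (25 * C'\<^sup>2 * D ^ 3) * q\<^sup>2"
      by (simp add: power_mult_distrib power3_eq_cube power2_eq_square mult_ac)
    then have "(T / (8 * pi\<^sup>2))\<^sup>2 * N\<^sup>2 * q \<le> 25 * C'\<^sup>2 * D ^ 3"
      using q by (simp only: mult_le_cancel_right) auto
    moreover have "(T / (8 * pi\<^sup>2))\<^sup>2 * N\<^sup>2 * q = c * N"
    proof -
      have "N\<^sup>2 * q = N / (32 * T * (1 + 8 * T))" using N by (simp add: q_def power2_eq_square)
      then show ?thesis unfolding c_def by (simp add: mult.assoc)
    qed
    ultimately show ?thesis by simp
  qed
  \<comment> \<open>The first two summands secure the hypotheses of \<open>main\<close>; the last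
    alone already brings \<open>c * N\<close> up to the claimed bound, and the others push it
    beyond.\<close>
  define N where "N = 4 + 1 / (32 * T) + (25 * C'\<^sup>2 * D ^ 3) / c"
  have pos: "0 \<le> (25 * C'\<^sup>2 * D ^ 3) / c" using c D by simp
  have "1 / (32 * T) \<le> N" using pos by (simp add: N_def)
  then have "1 \<le> 32 * T * N" using \<open>0 < T\<close> by (simp add: divide_le_eq mult_ac)
  moreover have "4 \<le> N" using pos \<open>0 < T\<close> by (simp add: N_def)
  ultimately have "c * N \<le> 25 * C'\<^sup>2 * D ^ 3" by (rule main[rotated])
  moreover have "c * N = c * (4 + 1 / (32 * T)) + 25 * C'\<^sup>2 * D ^ 3" using c by (simp add: N_def distrib_left)
  moreover have "0 < c * (4 + 1 / (32 * T))" using c \<open>0 < T\<close> by (intro mult_pos_pos add_pos_pos) auto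
  ultimately show False by linarith
qed

end
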